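(* Let $n\ge 0$ be an integer that is not a triangular number, i.e. not of the form $k(k+1)/2$ with $k\ge 0$ an integer. Then for all integers $\alpha\ge 0$, $\beta\ge 0$ and every prime $p\ge 3$, $$v_0(2^{2\alpha+2}p^{2\beta}(8n+1))\equiv 0 \pmod{2^{3\alpha+9}}.$$
   Context: The integer sequence $v_0(n)$, $n\ge 0$, is defined by the generating function (formal power series in $q$) $$\sum_{n=0}^\infty v_0(n)q^n=\sum_{n=0}^\infty \frac{q^{n^2}(-q;q^2)_n}{(q;q^2)_n},$$ where $(a;q)_0=1$ and $(a;q)_n=\prod_{i=1}^n(1-aq^{i-1})$ for $n\ge1$, so that $(-q;q^2)_n=\prod_{i=1}^n(1+q^{2i-1})$ and $(q;q^2)_n=\prod_{i=1}^n(1-q^{2i-1})$. *)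

theory Defs
  imports
    "HOL-Computational_Algebra.Formal_Power_Series"
    "HOL-Computational_Algebra.Primes"
    "HOL-Number_Theory.Cong"
begin

definition qpoch :: "'a::comm_ring_1 \<Rightarrow> 'a \<Rightarrow> nat \<Rightarrow> 'a" where
  "qpoch a q n = (\<Prod>i=1..n. 1 - a * q ^ (i - 1))"

text \<open>
  The type \<^typ>\<open>int fps\<close> has no division, as \<^typ>\<open>int\<close> is not of class \<^class>\<open>inverse\<close>.
  The denominator \<open>(q;q\<^sup>2)\<^sub>n\<close> has constant coefficient \<open>1\<close>, so it is inverted with
  \<open>fps_right_inverse _ 1\<close>; see \<open>qpoch_mult_inverse\<close> below.
\<close>

definition v0_term :: "nat \<Rightarrow> int fps" where
  "v0_term n =
     fps_X ^ (n\<^sup>2) * qpoch (- fps_X) (fps_X\<^sup>2) n * fps_right_inverse (qpoch fps_X (fps_X\<^sup>2) n) 1"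

text \<open>
  The infinite sum is the limit in the \<open>X\<close>-adic metric of \<^typ>\<open>int fps\<close>; it converges by
  \<open>summable_v0_term\<close> below.
\<close>

definition v0 :: "nat \<Rightarrow> int" where
  "v0 n = fps_nth (\<Sum>m. v0_term m) n"

lemma qpoch_nth_0: "fps_nth (qpoch fps_X (fps_X\<^sup>2) n :: int fps) 0 = 1"
  by (induction n) (simp_all add: qpoch_def)

lemma qpoch_mult_inverse:
  "qpoch fps_X (fps_X\<^sup>2) n * fps_right_inverse (qpoch fps_X (fps_X\<^sup>2) n) 1 = (1 :: int fps)"
  by (rule fps_right_inverse) (simp add: qpoch_nth_0)

lemma v0_term_nth_eq_0: "k < n\<^sup>2 \<Longrightarrow> fps_nth (v0_term n) k = 0"
  by (simp add: v0_term_def mult.assoc fps_X_power_mult_nth)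

lemma summable_v0_term: "summable v0_term"
proof -
  have "(\<lambda>N. \<Sum>n<N. v0_term n) \<longlonglongrightarrow> Abs_fps (\<lambda>k. \<Sum>n\<le>k. fps_nth (v0_term n) k)"
  proof (rule tendsto_fpsI)
    fix k
    show "\<forall>\<^sub>F N in sequentially. fps_nth (\<Sum>n<N. v0_term n) k =
            fps_nth (Abs_fps (\<lambda>k. \<Sum>n\<le>k. fps_nth (v0_term n) k)) k"
      using eventually_gt_at_top[of k]
    proof eventually_elim
      case (elim N)
      have "(\<Sum>n<N. fps_nth (v0_term n) k) = (\<Sum>n\<le>k. fps_nth (v0_term n) k)"
      proof (rule sum.mono_neutral_right)
        show "\<forall>n\<in>{..<N} - {..k}. fps_nth (v0_term n) k = 0"
        proof
          fix n assume "n \<in> {..<N} - {..k}"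
          then have "k < n" by auto
          also have "n \<le> n\<^sup>2" by (simp add: power2_eq_square)
          finally show "fps_nth (v0_term n) k = 0" by (rule v0_term_nth_eq_0)
        qed
      qed (use elim in auto)
      then show ?case by (simp add: fps_sum_nth)
    qed
  qed
  then show ?thesis by (auto simp: summable_def sums_def)
qed

end

theory Submission
  imports Defs "HOL-Computational_Algebra.Formal_Laurent_Series"
begin

text \<open>
  Write \<open>\<phi>(q) = \<Sum>\<^sub>n q\<^bsup>n\<^sup>2\<^esup>\<close> over all integers and \<open>\<psi>(q) = \<Sum>\<^sub>k q\<^bsup>k(k+1)/2\<^esup>\<close> over \<open>k \<ge> 0\<close>.
  If \<open>V(q) = \<Sum> v\<^sub>0(n) q\<^sup>n\<close>, then \<open>V(q) + V(-q) - 1\<close> is the bilateral series with the same summand, a case of the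
  bilateral Kummer sum: multiplied by \<open>(q\<^sup>2;q\<^sup>4)\<^sub>\<infinity>\<close> it becomes a triple sum, which a change of variables and
  Gauss's alternating sum of \<open>q\<close>-binomial coefficients evaluate as \<open>\<phi>(q\<^sup>2) (-q\<^sup>2;q\<^sup>4)\<^sub>\<infinity>\<close>. With classical identities
  for \<open>\<phi>\<close> this gives \<open>2 \<Sum> v\<^sub>0(4n) q\<^sup>n - 1 = \<phi>(q)\<^sup>2/\<phi>(-q)\<close>.

  Put \<open>w = \<phi>(q)\<^sup>4/\<phi>(-q)\<^sup>4 - 1 = 16q\<psi>(q\<^sup>2)\<^sup>4/\<phi>(-q)\<^sup>4\<close>. Since \<open>\<phi>(\<plusminus>q) = \<phi>(q\<^sup>4) (1 \<plusminus> y)\<close> with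
  \<open>y = 2q\<psi>(q\<^sup>8)/\<phi>(q\<^sup>4)\<close>, and \<open>1/(1 - y\<^sup>4) = 1 + w(q\<^sup>4)\<close>, the residues modulo \<open>4\<close> of the exponents are read off from the
  powers of \<open>y\<close>. In terms of \<open>y\<close> one has \<open>w = 8y(1+y\<^sup>2)/(1-y)\<^sup>4\<close>, so extracting the exponents divisible by \<open>4\<close>
  maps \<open>\<phi> w \<int>[w]\<close> into \<open>8 \<phi> w \<int>[w]\<close>; this is the source of the factor \<open>2\<^bsup>3\<alpha>\<^esup>\<close>. Extracting the exponents \<open>1\<close>
  modulo \<open>8\<close> yields the even part of an element of \<open>16 \<psi>(q\<^sup>2) \<int>[w]\<close>, where the constant term contributes only at
  squares and the even part of \<open>w\<close> is divisible by \<open>2\<^sup>7\<close>.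
\<close>

section \<open>Locally finite sums of formal power series\<close>

text \<open>Each coefficient receives finitely many contributions. This unordered form of
  convergence suits index sets such as \<open>int\<close> or pairs, where sums are reindexed and
  interchanged without partial sums.\<close>

definition locally_finite :: "('i \<Rightarrow> 'a::comm_ring_1 fps) \<Rightarrow> 'i set \<Rightarrow> bool" where
  "locally_finite f I \<longleftrightarrow> (\<forall>j. finite {i\<in>I. fps_nth (f i) j \<noteq> 0})"

text \<open>A coefficient with infinite support gets 0, the value of \<open>sum\<close> over an
  infinite set; rules that need genuine sums therefore assume \<open>locally_finite\<close>.\<close>

definition lsum :: "('i \<Rightarrow> 'a::comm_ring_1 fps) \<Rightarrow> 'i set \<Rightarrow> 'a fps" where
  "lsum f I = Abs_fps (\<lambda>j. \<Sum>i\<in>{i\<in>I. fps_nth (f i) j \<noteq> 0}. fps_nth (f i) j)"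

lemma locally_finiteD: "locally_finite f I \<Longrightarrow> finite {i\<in>I. fps_nth (f i) j \<noteq> 0}"
  by (simp add: locally_finite_def)

lemma locally_finiteI:
  assumes "\<And>i j. i \<in> I \<Longrightarrow> j < d i \<Longrightarrow> fps_nth (f i) j = 0"
    and "\<And>j. finite {i\<in>I. d i \<le> (j::nat)}"
  shows "locally_finite f I"
  unfolding locally_finite_def
proof
  fix j
  have "{i\<in>I. fps_nth (f i) j \<noteq> 0} \<subseteq> {i\<in>I. d i \<le> j}"
    using assms(1) by (auto simp: not_le[symmetric])
  then show "finite {i\<in>I. fps_nth (f i) j \<noteq> 0}"
    using assms(2) finite_subset by blast
qed

lemma lsum_nth:
  assumes "finite S" "S \<subseteq> I" "\<And>i. i \<in> I \<Longrightarrow> i \<notin> S \<Longrightarrow> fps_nth (f i) j = 0"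
  shows "fps_nth (lsum f I) j = (\<Sum>i\<in>S. fps_nth (f i) j)"
  unfolding lsum_def fps_nth_Abs_fps
  by (rule sum.mono_neutral_left) (use assms in auto)

lemma lsum_cong: "(\<And>i. i \<in> I \<Longrightarrow> f i = g i) \<Longrightarrow> lsum f I = lsum g I"
  by (auto simp: lsum_def fps_eq_iff intro!: sum.cong)

lemma locally_finite_cong: "(\<And>i. i \<in> I \<Longrightarrow> f i = g i) \<Longrightarrow> locally_finite f I \<longleftrightarrow> locally_finite g I"
  by (simp add: locally_finite_def cong: conj_cong)

lemma locally_finite_subset: "locally_finite f I \<Longrightarrow> J \<subseteq> I \<Longrightarrow> locally_finite f J"
  unfolding locally_finite_def
proof safe
  fix j assume "\<forall>j. finite {i\<in>I. fps_nth (f i) j \<noteq> 0}" "J \<subseteq> I"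
  then show "finite {i\<in>J. fps_nth (f i) j \<noteq> 0}"
    by (elim allE[of _ j] finite_subset[rotated]) auto
qed

lemma lsum_finite: "finite I \<Longrightarrow> lsum f I = sum f I"
  by (rule fps_ext, subst lsum_nth[of I]) (simp_all add: fps_sum_nth)

lemma lsum_reindex:
  assumes "bij_betw h J I"
  shows "lsum f I = lsum (\<lambda>x. f (h x)) J"
proof (rule fps_ext)
  fix j
  have "bij_betw h {x\<in>J. fps_nth (f (h x)) j \<noteq> 0} {i\<in>I. fps_nth (f i) j \<noteq> 0}"
    using assms by (auto simp: bij_betw_def inj_on_def)
  from sum.reindex_bij_betw[OF this, of "\<lambda>i. fps_nth (f i) j"]
  show "fps_nth (lsum f I) j = fps_nth (lsum (\<lambda>x. f (h x)) J) j"
    by (simp add: lsum_def)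
qed

lemma locally_finite_reindex:
  assumes "bij_betw h J I"
  shows "locally_finite f I \<longleftrightarrow> locally_finite (\<lambda>x. f (h x)) J"
proof -
  have "bij_betw h {x\<in>J. fps_nth (f (h x)) j \<noteq> 0} {i\<in>I. fps_nth (f i) j \<noteq> 0}" for j
    using assms by (auto simp: bij_betw_def inj_on_def)
  from bij_betw_finite[OF this] show ?thesis by (simp add: locally_finite_def)
qed

text \<open>For a fixed exponent all contributions sit on one finite set of pairs, so only a finite
  sum has to be split into fibres.\<close>

lemma lsum_Sigma:
  assumes "locally_finite (\<lambda>(i, k). f i k) (Sigma I J)"
  shows "lsum (\<lambda>i. lsum (f i) (J i)) I = lsum (\<lambda>(i, k). f i k) (Sigma I J)"
proof (rule fps_ext)
  fix j
  define T where "T = {p \<in> Sigma I J. fps_nth (case p of (i, k) \<Rightarrow> f i k) j \<noteq> 0}"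
  define K where "K i = {k. (i, k) \<in> T}" for i
  have T: "finite T" using locally_finiteD[OF assms, of j] by (simp add: T_def)
  have K: "finite (K i)" for i
  proof -
    have "K i \<subseteq> snd ` T" by (force simp: K_def)
    then show ?thesis using T finite_subset by blast
  qed
  have inner: "fps_nth (lsum (f i) (J i)) j = (\<Sum>k\<in>K i. fps_nth (f i k) j)" if "i \<in> I" for i
    by (rule lsum_nth[OF K]) (use that in \<open>auto simp: K_def T_def\<close>)
  have "fps_nth (lsum (\<lambda>i. lsum (f i) (J i)) I) j = (\<Sum>i\<in>fst ` T. fps_nth (lsum (f i) (J i)) j)"
  proof (rule lsum_nth)
    fix i assume i: "i \<in> I" "i \<notin> fst ` T"
    then have "K i = {}" by (force simp: K_def)
    then show "fps_nth (lsum (f i) (J i)) j = 0" using inner i by simp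
  qed (use T in \<open>auto simp: T_def\<close>)
  also have "\<dots> = (\<Sum>i\<in>fst ` T. \<Sum>k\<in>K i. fps_nth (f i k) j)"
    by (intro sum.cong inner refl) (auto simp: T_def)
  also have "\<dots> = (\<Sum>(i, k)\<in>Sigma (fst ` T) K. fps_nth (f i k) j)"
    by (rule sum.Sigma) (use T K in auto)
  also have "Sigma (fst ` T) K = T" by (force simp: K_def)
  also have "(\<Sum>(i, k)\<in>T. fps_nth (f i k) j) = fps_nth (lsum (\<lambda>(i, k). f i k) (Sigma I J)) j"
    by (subst lsum_nth[of T]) (use T in \<open>auto simp: T_def intro!: sum.cong\<close>)
  finally show "fps_nth (lsum (\<lambda>i. lsum (f i) (J i)) I) j = \<dots>" .
qed

lemma finite_support_atMost:
  assumes "locally_finite f I"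
  shows "finite (\<Union>b\<le>j. {i\<in>I. fps_nth (f i) b \<noteq> 0})"
  using locally_finiteD[OF assms] by blast

lemma locally_finite_mult_left:
  assumes "locally_finite f I"
  shows "locally_finite (\<lambda>i. c * f i) I"
  unfolding locally_finite_def
proof
  fix j
  have "fps_nth (c * f i) j = 0" if "\<And>b. b \<le> j \<Longrightarrow> fps_nth (f i) b = 0" for i
    by (simp add: fps_mult_nth that)
  then have "{i\<in>I. fps_nth (c * f i) j \<noteq> 0} \<subseteq> (\<Union>b\<le>j. {i\<in>I. fps_nth (f i) b \<noteq> 0})" by auto
  then show "finite {i\<in>I. fps_nth (c * f i) j \<noteq> 0}"
    using finite_support_atMost[OF assms] finite_subset by blast
qed

lemma lsum_mult_left:
  assumes "locally_finite f I"
  shows "lsum (\<lambda>i. c * f i) I = c * lsum f I"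
proof (rule fps_ext)
  fix j
  \<comment> \<open>The j-th coefficient of a product sees all coefficients up to j, so
    \<open>S\<close> collects the supports in all these degrees.\<close>
  define S where "S = (\<Union>b\<le>j. {i\<in>I. fps_nth (f i) b \<noteq> 0})"
  have S: "finite S" using finite_support_atMost[OF assms] by (simp add: S_def)
  have b: "fps_nth (lsum f I) b = (\<Sum>i\<in>S. fps_nth (f i) b)" if "b \<le> j" for b
    by (rule lsum_nth) (use S that in \<open>auto simp: S_def\<close>)
  have "fps_nth (c * lsum f I) j = (\<Sum>a=0..j. \<Sum>i\<in>S. fps_nth c a * fps_nth (f i) (j - a))"
    by (simp add: fps_mult_nth b sum_distrib_left)
  also have "\<dots> = (\<Sum>i\<in>S. fps_nth (c * f i) j)"
    by (subst sum.swap) (simp add: fps_mult_nth)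
  also have "\<dots> = fps_nth (lsum (\<lambda>i. c * f i) I) j"
  proof (rule lsum_nth[symmetric])
    fix i assume "i \<in> I" "i \<notin> S"
    then show "fps_nth (c * f i) j = 0" by (simp add: fps_mult_nth S_def)
  qed (use S in \<open>auto simp: S_def\<close>)
  finally show "fps_nth (lsum (\<lambda>i. c * f i) I) j = fps_nth (c * lsum f I) j" ..
qed

lemma lsum_add:
  assumes "locally_finite f I" "locally_finite g I"
  shows "lsum (\<lambda>i. f i + g i) I = lsum f I + lsum g I"
proof (rule fps_ext)
  fix j
  define S where "S = {i\<in>I. fps_nth (f i) j \<noteq> 0} \<union> {i\<in>I. fps_nth (g i) j \<noteq> 0}"
  have S: "finite S" "S \<subseteq> I" using assms by (auto simp: S_def dest: locally_finiteD)
  show "fps_nth (lsum (\<lambda>i. f i + g i) I) j = fps_nth (lsum f I + lsum g I) j"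
    by (simp, subst (1 2 3) lsum_nth[of S]) (use S in \<open>auto simp: S_def sum.distrib\<close>)
qed

lemma lsum_Un:
  assumes "locally_finite f (I \<union> J)" "I \<inter> J = {}"
  shows "lsum f (I \<union> J) = lsum f I + lsum f J"
proof (rule fps_ext)
  fix j
  have "{i \<in> I \<union> J. fps_nth (f i) j \<noteq> 0} = {i \<in> I. fps_nth (f i) j \<noteq> 0} \<union> {i \<in> J. fps_nth (f i) j \<noteq> 0}"
    by auto
  moreover have "finite {i \<in> I. fps_nth (f i) j \<noteq> 0}" "finite {i \<in> J. fps_nth (f i) j \<noteq> 0}"
    using locally_finite_subset[OF assms(1)] by (auto dest: locally_finiteD)
  ultimately show "fps_nth (lsum f (I \<union> J)) j = fps_nth (lsum f I + lsum f J) j"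
    using assms(2) by (auto simp: lsum_def intro!: sum.union_disjoint)
qed

lemma locally_finite_times:
  assumes "locally_finite f I" "locally_finite g J"
  shows "locally_finite (\<lambda>(i, k). f i * g k) (I \<times> J)"
  unfolding locally_finite_def
proof
  fix j
  have "fps_nth (f i * g k) j = 0"
    if "(\<forall>b\<le>j. fps_nth (f i) b = 0) \<or> (\<forall>b\<le>j. fps_nth (g k) b = 0)" for i k
    using that by (auto simp: fps_mult_nth)
  then have "{p \<in> I \<times> J. fps_nth (case p of (i, k) \<Rightarrow> f i * g k) j \<noteq> 0}
        \<subseteq> (\<Union>b\<le>j. {i\<in>I. fps_nth (f i) b \<noteq> 0}) \<times> (\<Union>b\<le>j. {k\<in>J. fps_nth (g k) b \<noteq> 0})"
    by fastforce
  then show "finite {p \<in> I \<times> J. fps_nth (case p of (i, k) \<Rightarrow> f i * g k) j \<noteq> 0}"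
    by (rule finite_subset) (intro finite_cartesian_product finite_support_atMost assms)
qed

lemma lsum_times:
  assumes "locally_finite f I" "locally_finite g J"
  shows "lsum f I * lsum g J = lsum (\<lambda>(i, k). f i * g k) (I \<times> J)"
proof -
  have "lsum f I * lsum g J = lsum (\<lambda>i. lsum g J * f i) I"
    using lsum_mult_left[OF assms(1), of "lsum g J"] by (simp add: mult.commute)
  also have "\<dots> = lsum (\<lambda>i. lsum (\<lambda>k. f i * g k) J) I"
    by (simp add: lsum_mult_left[OF assms(2)] mult.commute)
  also have "\<dots> = lsum (\<lambda>(i, k). f i * g k) (I \<times> J)"
    by (rule lsum_Sigma) (rule locally_finite_times[OF assms])
  finally show ?thesis .
qed

lemma lsum_compose:
  assumes "locally_finite f I"
  shows "lsum f I oo h = lsum (\<lambda>i. f i oo h) I"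
proof (rule fps_ext)
  fix j
  define S where "S = (\<Union>b\<le>j. {i\<in>I. fps_nth (f i) b \<noteq> 0})"
  have S: "finite S" using finite_support_atMost[OF assms] by (simp add: S_def)
  have b: "fps_nth (lsum f I) b = (\<Sum>i\<in>S. fps_nth (f i) b)" if "b \<le> j" for b
    by (rule lsum_nth) (use S that in \<open>auto simp: S_def\<close>)
  have "fps_nth (lsum f I oo h) j = (\<Sum>a=0..j. \<Sum>i\<in>S. fps_nth (f i) a * fps_nth (h ^ a) j)"
    by (simp add: fps_compose_nth b sum_distrib_right)
  also have "\<dots> = (\<Sum>i\<in>S. fps_nth (f i oo h) j)"
    by (subst sum.swap) (simp add: fps_compose_nth)
  also have "\<dots> = fps_nth (lsum (\<lambda>i. f i oo h) I) j"
  proof (rule lsum_nth[symmetric])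
    fix i assume "i \<in> I" "i \<notin> S"
    then show "fps_nth (f i oo h) j = 0" by (simp add: fps_compose_nth S_def)
  qed (use S in \<open>auto simp: S_def\<close>)
  finally show "fps_nth (lsum f I oo h) j = fps_nth (lsum (\<lambda>i. f i oo h) I) j" .
qed

lemma lsum_mono_neutral:
  assumes "J \<subseteq> I" "\<And>i. i \<in> I - J \<Longrightarrow> f i = 0"
  shows "lsum f I = lsum f J"
proof -
  have "{i\<in>I. fps_nth (f i) j \<noteq> 0} = {i\<in>J. fps_nth (f i) j \<noteq> 0}" for j
    using assms by force
  then show ?thesis by (simp add: lsum_def)
qed

lemma fps_nth_power_mult_eq_0:
  fixes z :: "'a::idom fps"
  assumes "fps_nth z 0 = 0" "j < N"
  shows "fps_nth (z ^ N * f) j = 0"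
  unfolding fps_mult_nth
  by (intro sum.neutral ballI) (use startsby_zero_power_prefix[OF assms(1), of N] assms(2) in auto)

lemma nat_square_le_imp_abs_le:
  assumes "nat (x\<^sup>2) \<le> j"
  shows "\<bar>x\<bar> \<le> int j"
proof -
  have "\<bar>x\<bar> * 1 \<le> \<bar>x\<bar> * \<bar>x\<bar>" by (cases "x = 0") (simp, rule mult_left_mono, auto)
  also have "\<dots> = x\<^sup>2" by (simp add: power2_eq_square)
  finally show ?thesis using assms by linarith
qed

section \<open>The reciprocals 1/(q^2;q^2)_k and Gauss's alternating sum\<close>

definition qinv :: "nat \<Rightarrow> int fps" where
  "qinv k = fps_right_inverse (qpoch (fps_X\<^sup>2) (fps_X\<^sup>2) k) 1"

lemma qpoch_Suc: "qpoch a q (Suc n) = qpoch a q n * (1 - a * q ^ n)"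
  by (simp add: qpoch_def)

lemma qpoch_0 [simp]: "qpoch a q 0 = 1"
  by (simp add: qpoch_def)

lemma qpoch_qinv: "qpoch (fps_X\<^sup>2) (fps_X\<^sup>2) k * qinv k = 1"
  unfolding qinv_def
proof (rule fps_right_inverse)
  have "fps_nth (qpoch (fps_X\<^sup>2) (fps_X\<^sup>2) k) 0 = (1::int)"
    by (induction k) (simp_all add: qpoch_Suc)
  then show "fps_nth (qpoch (fps_X\<^sup>2) (fps_X\<^sup>2) k) 0 * 1 = (1::int)" by simp
qed

lemma qinv_0 [simp]: "qinv 0 = 1"
  using qpoch_qinv[of 0] by simp

lemma qinv_Suc: "(1 - fps_X ^ (2 * Suc k)) * qinv (Suc k) = qinv k"
proof -
  let ?P = "qpoch (fps_X\<^sup>2) (fps_X\<^sup>2) :: nat \<Rightarrow> int fps"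
  have "?P k * ((1 - fps_X ^ (2 * Suc k)) * qinv (Suc k)) = ?P (Suc k) * qinv (Suc k)"
    by (simp add: qpoch_Suc mult.assoc flip: power_mult power_Suc power_add)
  also have "\<dots> = ?P k * qinv k" by (simp only: qpoch_qinv)
  finally show ?thesis
    using qpoch_qinv[of k] by (metis mult_cancel_left mult_zero_left zero_neq_one)
qed

lemma one_minus_X_power_neq_0: "n > 0 \<Longrightarrow> 1 - fps_X ^ n \<noteq> (0 :: 'a::idom fps)"
  by (metis fps_X_power_nth fps_nonzero_nth fps_one_nth fps_sub_nth diff_zero less_not_refl
      one_neq_zero)

text \<open>Multiplied by (q^2;q^2)_d this is Gauss's alternating sum of q-binomial coefficients in
  base q^2.\<close>

definition gauss_sum :: "nat \<Rightarrow> int fps" where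
  "gauss_sum d = (\<Sum>k\<le>d. (-1) ^ k * (qinv k * qinv (d - k)))"

text \<open>Split 1 - q^(2(d+2)) as (1 - q^(2k)) + q^(2k) (1 - q^(2(d+2-k))). By
  \<open>qinv_Suc\<close> each part lowers an index; the two sums recombine with a factor 1 -
  q^(2k), which lowers an index once more.\<close>

lemma gauss_sum_rec: "(1 - fps_X ^ (2 * (d + 2))) * gauss_sum (d + 2) = gauss_sum d"
proof -
  define q :: "nat \<Rightarrow> int fps" where "q k = fps_X ^ (2 * k)" for k
  define e where "e = qinv"
  have rec: "(1 - q (Suc k)) * e (Suc k) = e k" for k
    using qinv_Suc by (simp add: q_def e_def)
  have q0: "q 0 = 1" by (simp add: q_def)
  have "(1 - q (d + 2)) * gauss_sum (d + 2)
     = (\<Sum>k\<le>d+2. (-1) ^ k * ((1 - q k) * e k * e (d + 2 - k)) +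
                 (-1) ^ k * (q k * e k * ((1 - q (d + 2 - k)) * e (d + 2 - k))))"
    unfolding gauss_sum_def sum_distrib_left
  proof (rule sum.cong, goal_cases)
    case (2 k)
    then have "2 * (d + 2) = 2 * k + 2 * (d + 2 - k)" by simp
    then have "q (d + 2) = q k * q (d + 2 - k)" by (simp only: q_def power_add[symmetric])
    then show ?case by (simp add: e_def algebra_simps)
  qed simp
  also have "\<dots> = (\<Sum>k\<le>d+2. (-1) ^ k * ((1 - q k) * e k * e (d + 2 - k))) +
                 (\<Sum>k\<le>d+2. (-1) ^ k * (q k * e k * ((1 - q (d + 2 - k)) * e (d + 2 - k))))"
    by (rule sum.distrib)
  also have "(\<Sum>k\<le>d+2. (-1) ^ k * ((1 - q k) * e k * e (d + 2 - k)))
     = (\<Sum>k\<le>d+1. - ((-1) ^ k * (e k * e (d + 1 - k))))"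
  proof -
    \<comment> \<open>The term k = 0 vanishes, and the shift of k by one produces the sign.\<close>
    have "(\<Sum>k\<le>Suc (d+1). (-1) ^ k * ((1 - q k) * e k * e (d + 2 - k)))
      = (\<Sum>k\<le>d+1. - ((-1) ^ k * (e k * e (d + 1 - k))))"
      by (subst sum.atMost_Suc_shift) (simp add: q0 rec)
    then show ?thesis by simp
  qed
  also have "(\<Sum>k\<le>d+2. (-1) ^ k * (q k * e k * ((1 - q (d + 2 - k)) * e (d + 2 - k))))
     = (\<Sum>k\<le>d+1. (-1) ^ k * (q k * e k * e (d + 1 - k)))"
  proof -
    define F where "F k = (-1) ^ k * (q k * e k * ((1 - q (d + 2 - k)) * e (d + 2 - k)))" for k
    have "(\<Sum>k\<le>d+1. F k) = (\<Sum>k\<le>d+1. (-1) ^ k * (q k * e k * e (d + 1 - k)))"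
    proof (rule sum.cong)
      fix k assume "k \<in> {..d+1}"
      then have "d + 2 - k = Suc (d + 1 - k)" by auto
      then show "F k = (-1) ^ k * (q k * e k * e (d + 1 - k))" by (simp only: F_def rec)
    qed simp
    moreover have "F (Suc (d + 1)) = 0" by (simp add: F_def q0)
    ultimately have "(\<Sum>k\<le>Suc (d+1). F k) = (\<Sum>k\<le>d+1. (-1) ^ k * (q k * e k * e (d + 1 - k)))"
      by (simp only: sum.atMost_Suc add_0_right)
    then have "(\<Sum>k\<le>d+2. F k) = (\<Sum>k\<le>d+1. (-1) ^ k * (q k * e k * e (d + 1 - k)))"
      by simp
    then show ?thesis by (simp only: F_def)
  qed
  also have "(\<Sum>k\<le>d+1. - ((-1) ^ k * (e k * e (d + 1 - k)))) +
             (\<Sum>k\<le>d+1. (-1) ^ k * (q k * e k * e (d + 1 - k)))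
     = (\<Sum>k\<le>d+1. - ((-1) ^ k * ((1 - q k) * e k * e (d + 1 - k))))"
    by (simp only: sum.distrib[symmetric], rule sum.cong) (simp_all add: algebra_simps)
  also have "\<dots> = gauss_sum d"
  proof -
    have "(\<Sum>k\<le>Suc d. - ((-1) ^ k * ((1 - q k) * e k * e (d + 1 - k)))) = gauss_sum d"
      by (subst sum.atMost_Suc_shift) (simp add: q0 rec gauss_sum_def e_def[symmetric])
    then show ?thesis by simp
  qed
  finally show ?thesis by (simp only: q_def)
qed

lemma gauss_sum_odd: "gauss_sum (2 * m + 1) = 0"
proof (induction m)
  case 0
  show ?case by (simp add: gauss_sum_def)
next
  case (Suc m)
  have "gauss_sum (2 * m + 1 + 2) = 0"
    using gauss_sum_rec[of "2 * m + 1"] Suc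
      one_minus_X_power_neq_0[of "2 * (2 * m + 1 + 2)", where 'a = int] by simp
  then show ?case by simp
qed

lemma gauss_sum_even: "gauss_sum (2 * m) = qinv m oo fps_X\<^sup>2"
proof (induction m)
  case 0
  show ?case by (simp add: gauss_sum_def)
next
  case (Suc m)
  have X: "(1 - fps_X ^ (2 * Suc m)) oo fps_X\<^sup>2 = 1 - (fps_X ^ (2 * (2 * m + 2)) :: int fps)"
  proof -
    have "2 * (2 * m + 2) = 2 * (2 * Suc m)" by simp
    then show ?thesis
      by (subst fps_compose_sub_distrib, subst fps_X_power_compose) (simp_all only: power_mult, auto)
  qed
  have "(1 - fps_X ^ (2 * (2 * m + 2))) * gauss_sum (2 * m + 2) = qinv m oo fps_X\<^sup>2"
    using gauss_sum_rec[of "2 * m"] Suc by simp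
  also have "\<dots> = ((1 - fps_X ^ (2 * Suc m)) * qinv (Suc m)) oo fps_X\<^sup>2"
    by (simp only: qinv_Suc)
  also have "\<dots> = (1 - fps_X ^ (2 * (2 * m + 2))) * (qinv (Suc m) oo fps_X\<^sup>2)"
    by (subst fps_compose_mult_distrib) (simp_all only: X, simp)
  finally show ?case
    using one_minus_X_power_neq_0[of "2 * (2 * m + 2)", where 'a = int] by simp
qed

section \<open>The series \<phi>(z), written \<open>theta z\<close>, and Euler's series
  \<open>gser\<close>\<close>

definition theta :: "int fps \<Rightarrow> int fps" where
  "theta z = lsum (\<lambda>n::int. z ^ nat (n\<^sup>2)) UNIV"

text \<open>
  For \<open>z = \<plusminus>q\<close> this is \<open>z\<^bsup>n\<^sup>2\<^esup> (-z\<^bsup>1-2n\<^esup>;q\<^sup>2)\<^sub>\<infinity>\<close> expanded by Euler's identity; the series, unlike the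
  product, involves no negative powers.
\<close>

definition gser :: "int fps \<Rightarrow> int \<Rightarrow> int fps" where
  "gser z n = lsum (\<lambda>k. z ^ nat ((n - int k)\<^sup>2) * qinv k) UNIV"

lemma locally_finite_theta:
  assumes "fps_nth z 0 = 0"
  shows "locally_finite (\<lambda>n::int. (z::int fps) ^ nat (n\<^sup>2)) UNIV"
proof (rule locally_finiteI)
  fix n :: int and j
  assume "j < nat (n\<^sup>2)"
  then show "fps_nth (z ^ nat (n\<^sup>2)) j = 0"
    using fps_nth_power_mult_eq_0[OF assms, of j "nat (n\<^sup>2)" 1] by simp
next
  fix j
  have "{n \<in> UNIV. nat (n\<^sup>2) \<le> j} \<subseteq> {- int j..int j}"
    using nat_square_le_imp_abs_le by (force simp: abs_le_iff)
  then show "finite {n::int \<in> UNIV. nat (n\<^sup>2) \<le> j}" using finite_subset by blast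
qed

lemma locally_finite_gser:
  assumes "fps_nth z 0 = 0"
  shows "locally_finite (\<lambda>k. z ^ nat ((n - int k)\<^sup>2) * qinv k) UNIV"
proof (rule locally_finiteI)
  fix k j
  assume "j < nat ((n - int k)\<^sup>2)"
  then show "fps_nth (z ^ nat ((n - int k)\<^sup>2) * qinv k) j = 0"
    by (rule fps_nth_power_mult_eq_0[OF assms])
next
  fix j
  have "{k \<in> UNIV. nat ((n - int k)\<^sup>2) \<le> j} \<subseteq> {..nat (\<bar>n\<bar> + int j)}"
    using nat_square_le_imp_abs_le[of "n - int k" j for k] by fastforce
  then show "finite {k \<in> UNIV. nat ((n - int k)\<^sup>2) \<le> j}" using finite_subset by blast
qed

text \<open>Parallelogram law in the exponents; the signs agree because (c - d)^2, (c + d)^2 and c^2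
  + d^2 have the same parity.\<close>

lemma power_nat_squares:
  assumes "z1 = fps_X \<or> z1 = - fps_X" "z2 = fps_X \<or> z2 = - (fps_X :: int fps)"
  shows "z1 ^ nat ((c - d)\<^sup>2) * z2 ^ nat ((c + d)\<^sup>2)
       = (z1 * z2) ^ nat (c\<^sup>2) * (z1 * z2) ^ nat (d\<^sup>2)"
proof -
  define N where "N = nat (c\<^sup>2) + nat (d\<^sup>2)"
  have "int (nat ((c - d)\<^sup>2) + nat ((c + d)\<^sup>2)) = int (2 * N)"
    by (simp add: N_def) (simp add: power2_eq_square algebra_simps)
  then have X: "nat ((c - d)\<^sup>2) + nat ((c + d)\<^sup>2) = 2 * N"
    by (simp only: of_nat_eq_iff)
  have par: "even (nat ((c - d)\<^sup>2)) \<longleftrightarrow> even N" "even (nat ((c + d)\<^sup>2)) \<longleftrightarrow> even N"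
    by (simp_all add: N_def even_nat_iff)
  have "z1 ^ nat ((c - d)\<^sup>2) * z2 ^ nat ((c + d)\<^sup>2) = (z1 * z2) ^ N"
  proof -
    have "fps_X ^ nat ((c - d)\<^sup>2) * fps_X ^ nat ((c + d)\<^sup>2) = (fps_X * fps_X :: int fps) ^ N"
      by (simp only: power_add[symmetric] X power_mult power2_eq_square[symmetric])
    then show ?thesis
      using assms by (elim disjE; cases "even N") (simp_all add: par power_mult_distrib)
  qed
  then show ?thesis by (simp add: N_def power_add)
qed

section \<open>The bilateral series\<close>

text \<open>In this form the sum over m that \<open>bilateral_sum\<close> leaves can be recognised,
  for y = q^2 and y = -q^2.\<close>

lemma gser_compose_square:
  "gser fps_X 0 oo fps_X\<^sup>2 = lsum (\<lambda>m. (fps_X\<^sup>2) ^ (m\<^sup>2) * (qinv m oo fps_X\<^sup>2)) UNIV"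
  "gser (- fps_X) 0 oo fps_X\<^sup>2 = lsum (\<lambda>m. (- (fps_X\<^sup>2)) ^ (m\<^sup>2) * (qinv m oo fps_X\<^sup>2)) UNIV"
proof -
  have "gser z 0 oo fps_X\<^sup>2 = lsum (\<lambda>m. (z oo fps_X\<^sup>2) ^ (m\<^sup>2) * (qinv m oo fps_X\<^sup>2)) UNIV"
    if "fps_nth z 0 = 0" for z
  proof -
    have *: "nat ((0 - int m)\<^sup>2) = m\<^sup>2" for m by (simp add: nat_power_eq)
    have "gser z 0 oo fps_X\<^sup>2 = lsum (\<lambda>k. (z ^ nat ((0 - int k)\<^sup>2) * qinv k) oo fps_X\<^sup>2) UNIV"
      unfolding gser_def by (rule lsum_compose[OF locally_finite_gser[OF that]])
    then show ?thesis
      unfolding * by (simp add: fps_compose_mult_distrib fps_compose_power)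
  qed
  from this[of fps_X] this[of "- fps_X"]
  show "gser fps_X 0 oo fps_X\<^sup>2 = lsum (\<lambda>m. (fps_X\<^sup>2) ^ (m\<^sup>2) * (qinv m oo fps_X\<^sup>2)) UNIV"
    "gser (- fps_X) 0 oo fps_X\<^sup>2 = lsum (\<lambda>m. (- (fps_X\<^sup>2)) ^ (m\<^sup>2) * (qinv m oo fps_X\<^sup>2)) UNIV"
    by (simp_all add: fps_compose_uminus)
qed

text \<open>
  Expanding both factors gives a sum over \<open>n\<close>, \<open>k\<close>, \<open>l\<close> of \<open>\<plusminus>q\<^bsup>(n-k)\<^sup>2+(n+l)\<^sup>2\<^esup>\<close>. With \<open>r = n - k\<close> and
  \<open>d = k + l\<close> fixed, the sum over \<open>k\<close> is \<open>gauss_sum d\<close>; the surviving \<open>d = 2m\<close> and \<open>c = r + m\<close>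
  separate the variables.
\<close>

lemma bilateral_sum:
  assumes z1: "z1 = fps_X \<or> z1 = - fps_X" and z2: "z2 = fps_X \<or> z2 = - (fps_X :: int fps)"
  defines "y \<equiv> - z1 * z2"
  shows "lsum (\<lambda>n::int. (-1) ^ nat (n\<^sup>2) * (gser z1 n * gser z2 (- n))) UNIV
       = theta y * lsum (\<lambda>m. y ^ (m\<^sup>2) * (qinv m oo fps_X\<^sup>2)) UNIV"
proof -
  define T :: "int \<Rightarrow> nat \<times> nat \<Rightarrow> int fps" where
    "T n = (\<lambda>(k, l). (-1) ^ nat (n\<^sup>2) * (z1 ^ nat ((n - int k)\<^sup>2) * qinv k *
                                (z2 ^ nat ((- n - int l)\<^sup>2) * qinv l)))" for n
  define h :: "(int \<times> nat) \<times> nat \<Rightarrow> int \<times> (nat \<times> nat)" where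
    "h = (\<lambda>((r, d), k). (r + int k, (k, d - k)))"
  \<comment> \<open>\<open>C\<close> is the part of the summand free of k once r = n - k and d = k +
    l are fixed; the sign (-1)^(r^2) is absorbed into \<open>- z1\<close>.\<close>
  define C where "C = (\<lambda>(r::int, d::nat). (- z1) ^ nat (r\<^sup>2) * z2 ^ nat ((r + int d)\<^sup>2))"
  have z0: "fps_nth z1 0 = 0" "fps_nth z2 0 = 0" "fps_nth y 0 = 0"
    using z1 z2 by (auto simp: y_def)
  have locT: "locally_finite (\<lambda>(n, p). T n p) (UNIV \<times> UNIV)"
  proof (rule locally_finiteI)
    fix i :: "int \<times> (nat \<times> nat)" and j
    obtain n k l where i: "i = (n, (k, l))" by (cases i) auto
    assume "j < (case i of (n, (k, l)) \<Rightarrow> nat ((n - int k)\<^sup>2) + nat ((- n - int l)\<^sup>2))"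
    then have j: "j < nat ((n - int k)\<^sup>2) + nat ((- n - int l)\<^sup>2)" by (simp add: i)
    \<comment> \<open>Collecting the powers of \<open>z1\<close> and \<open>z2\<close> into one
      power of q, up to sign, makes the degree bound visible.\<close>
    have "T n (k, l) = (fps_X ^ (nat ((n - int k)\<^sup>2) + nat ((- n - int l)\<^sup>2))) * 
        ((-1) ^ nat (n\<^sup>2) * (if z1 = fps_X then 1 else (-1) ^ nat ((n - int k)\<^sup>2)) * 
          (if z2 = fps_X then 1 else (-1) ^ nat ((- n - int l)\<^sup>2)) * qinv k * qinv l)"
      using z1 z2 by (auto simp: T_def power_add power_minus[of fps_X] mult_ac)
    then show "fps_nth (case i of (n, p) \<Rightarrow> T n p) j = 0"
      using j by (simp add: i fps_nth_power_mult_eq_0)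
  next
    fix j
    have "n \<in> {-int j..int j} \<and> k \<in> {..2*j} \<and> l \<in> {..2*j}"
      if "nat ((n - int k)\<^sup>2) + nat ((- n - int l)\<^sup>2) \<le> j" for n k l
    proof -
      have "nat ((n - int k)\<^sup>2) \<le> j" "nat ((- n - int l)\<^sup>2) \<le> j" using that by linarith+
      then have "\<bar>n - int k\<bar> \<le> int j" "\<bar>- n - int l\<bar> \<le> int j"
        by (simp_all only: nat_square_le_imp_abs_le)
      then show ?thesis by auto
    qed
    then have "{i \<in> UNIV \<times> UNIV. (case i of (n, (k, l)) \<Rightarrow>
        nat ((n - int k)\<^sup>2) + nat ((- n - int l)\<^sup>2)) \<le> j} \<subseteq> {-int j..int j} \<times> ({..2*j} \<times> {..2*j})"
      by (force split: prod.splits)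
    then show "finite {i \<in> UNIV \<times> UNIV. (case i of (n, (k, l)) \<Rightarrow>
        nat ((n - int k)\<^sup>2) + nat ((- n - int l)\<^sup>2)) \<le> j}"
      by (rule finite_subset) simp
  qed
  have bij: "bij_betw h (SIGMA p:UNIV. {..snd p}) (UNIV \<times> UNIV)"
    by (rule bij_betwI[where g = "\<lambda>(n, (k, l)). ((n - int k, k + l), k)"]) (auto simp: h_def)

  have Th: "(case h x of (n, p) \<Rightarrow> T n p) =
      (case x of (p, k) \<Rightarrow> C p * ((-1) ^ k * (qinv k * qinv (snd p - k))))"
    if x: "x \<in> (SIGMA p:UNIV. {..snd p})" for x
  proof -
    obtain r d k where x': "x = ((r, d), k)" by (metis surj_pair)
    have k: "k \<le> d" using x by (simp add: x')
    have s: "(-1 :: int fps) ^ nat ((r + int k)\<^sup>2) = (-1) ^ nat (r\<^sup>2) * (-1) ^ k"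
    proof -
      have "even (nat ((r + int k)\<^sup>2)) \<longleftrightarrow> even (nat (r\<^sup>2) + k)" by (simp add: even_nat_iff)
      then show ?thesis
        unfolding power_add[symmetric] by (cases "even (nat (r\<^sup>2) + k)") simp_all
    qed
    have "(- (r + int k) - int (d - k))\<^sup>2 = (r + int d)\<^sup>2"
      using k by (simp add: of_nat_diff power2_eq_square algebra_simps)
    then show ?thesis
      by (simp add: x' h_def T_def C_def s power_minus[of z1] mult_ac)
  qed
  have "lsum (\<lambda>n::int. (-1) ^ nat (n\<^sup>2) * (gser z1 n * gser z2 (- n))) UNIV
      = lsum (\<lambda>n. lsum (T n) UNIV) UNIV"
  proof (rule lsum_cong)
    fix n :: int
    have "gser z1 n * gser z2 (- n) = lsum (\<lambda>(k, l). z1 ^ nat ((n - int k)\<^sup>2) * qinv k *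
        (z2 ^ nat ((- n - int l)\<^sup>2) * qinv l)) (UNIV \<times> UNIV)"
      unfolding gser_def by (rule lsum_times) (intro locally_finite_gser z0)+
    moreover have "locally_finite (\<lambda>(k, l). z1 ^ nat ((n - int k)\<^sup>2) * qinv k *
        (z2 ^ nat ((- n - int l)\<^sup>2) * qinv l)) (UNIV \<times> UNIV)"
      by (rule locally_finite_times) (intro locally_finite_gser z0)+
    ultimately show "(-1) ^ nat (n\<^sup>2) * (gser z1 n * gser z2 (- n)) = lsum (T n) UNIV"
      by (simp add: lsum_mult_left[symmetric] T_def case_prod_unfold)
  qed
  also have "\<dots> = lsum (\<lambda>(n, p). T n p) (UNIV \<times> UNIV)"
    by (rule lsum_Sigma[OF locT])
  also have "\<dots> = lsum (\<lambda>x. case h x of (n, p) \<Rightarrow> T n p) (SIGMA p:UNIV. {..snd p})"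
    by (rule lsum_reindex[OF bij])
  also have "\<dots> = lsum (\<lambda>(p, k). C p * ((-1) ^ k * (qinv k * qinv (snd p - k)))) (SIGMA p:UNIV. {..snd p})"
    by (rule lsum_cong[OF Th])
  also have "\<dots> = lsum (\<lambda>p. lsum (\<lambda>k. C p * ((-1) ^ k * (qinv k * qinv (snd p - k)))) {..snd p}) UNIV"
  proof (rule lsum_Sigma[symmetric])
    have "locally_finite (\<lambda>x. case h x of (n, p) \<Rightarrow> T n p) (SIGMA p:UNIV. {..snd p})"
      by (rule iffD1[OF locally_finite_reindex[OF bij] locT])
    also have "locally_finite (\<lambda>x. case h x of (n, p) \<Rightarrow> T n p) (SIGMA p:UNIV. {..snd p}) \<longleftrightarrow>
      locally_finite (\<lambda>(p, k). C p * ((-1) ^ k * (qinv k * qinv (snd p - k)))) (SIGMA p:UNIV. {..snd p})"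
      by (rule locally_finite_cong[OF Th])
    finally show "locally_finite (\<lambda>(p, k). C p * ((-1) ^ k * (qinv k * qinv (snd p - k))))
      (SIGMA p:UNIV. {..snd p})" .
  qed
  also have "\<dots> = lsum (\<lambda>p. C p * gauss_sum (snd p)) UNIV"
    by (rule lsum_cong) (simp add: lsum_finite gauss_sum_def sum_distrib_left)
  also have "\<dots> = lsum (\<lambda>p. C p * gauss_sum (snd p)) {p. even (snd p)}"
  proof (rule lsum_mono_neutral)
    fix p :: "int \<times> nat" assume "p \<in> UNIV - {p. even (snd p)}"
    then obtain m where "snd p = 2 * m + 1" by (auto elim: oddE)
    then show "C p * gauss_sum (snd p) = 0" by (simp only: gauss_sum_odd mult_zero_right)
  qed simp
  also have "\<dots> = lsum (\<lambda>x. case x of (c, m) \<Rightarrow> C (c - int m, 2 * m) * gauss_sum (2 * m)) (UNIV \<times> UNIV)"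
  proof (subst lsum_reindex)
    show "bij_betw (\<lambda>(c, m). (c - int m, 2 * m)) (UNIV \<times> UNIV) {p. even (snd p)}"
      by (rule bij_betwI[where g = "\<lambda>(r, d). (r + int (d div 2), d div 2)"]) auto
  qed (simp add: case_prod_unfold)
  also have "\<dots> = lsum (\<lambda>(c, m). y ^ nat (c\<^sup>2) * (y ^ (m\<^sup>2) * (qinv m oo fps_X\<^sup>2))) (UNIV \<times> UNIV)"
  proof (rule lsum_cong)
    fix x :: "int \<times> nat"
    obtain c m where x: "x = (c, m)" by (cases x)
    \<comment> \<open>The exponents are (c - m)^2 and (c + m)^2, so \<open>power_nat_squares\<close>
      separates c from m.\<close>
    have "C (c - int m, 2 * m) = y ^ nat (c\<^sup>2) * y ^ (m\<^sup>2)"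
      using power_nat_squares[of "- z1" z2 c "int m"] z1 z2
      by (auto simp: C_def y_def nat_power_eq add.commute[of c])
    then show "(case x of (c, m) \<Rightarrow> C (c - int m, 2 * m) * gauss_sum (2 * m)) =
        (case x of (c, m) \<Rightarrow> y ^ nat (c\<^sup>2) * (y ^ (m\<^sup>2) * (qinv m oo fps_X\<^sup>2)))"
      by (simp add: x gauss_sum_even mult.assoc)
  qed
  also have "\<dots> = theta y * lsum (\<lambda>m. y ^ (m\<^sup>2) * (qinv m oo fps_X\<^sup>2)) UNIV"
    unfolding theta_def
  proof (rule lsum_times[symmetric])
    show "locally_finite (\<lambda>m. y ^ (m\<^sup>2) * (qinv m oo fps_X\<^sup>2)) UNIV"
    proof (rule locally_finiteI)
      fix j :: nat
      have "m \<le> m\<^sup>2" for m :: nat by (simp add: power2_eq_square)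
      then have "{m \<in> UNIV. m\<^sup>2 \<le> j} \<subseteq> {..j}" by (auto intro: order_trans)
      then show "finite {m \<in> UNIV. m\<^sup>2 \<le> j}" using finite_subset by blast
    qed (rule fps_nth_power_mult_eq_0[OF z0(3)])
  qed (rule locally_finite_theta[OF z0(3)])
  finally show ?thesis .
qed

text \<open>By \<open>qinv_Suc\<close>, 1/(q^2;q^2)_k is 1/(q^2;q^2)_(k-1) plus q^(2k)/(q^2;q^2)_k,
  and (n+1-k)^2 + 2k = (n-k)^2 + 2n + 1. The second claim is the first one at index -n-1, multiplied
  by z^(2n+1) to clear the negative power.\<close>

lemma gser_step:
  assumes "z = fps_X \<or> z = - (fps_X :: int fps)"
  shows "gser z (int n + 1) = (1 + z ^ (2 * n + 1)) * gser z (int n)"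
    and "z ^ (2 * n + 1) * gser z (- int n) = (1 + z ^ (2 * n + 1)) * gser z (- int n - 1)"
proof -
  have z0: "fps_nth z 0 = 0" using assms by auto
  have zX: "z ^ (2 * k) = fps_X ^ (2 * k)" for k using assms by auto
  define T where "T n k = z ^ nat ((n - int k)\<^sup>2) * qinv k" for n k
  \<comment> \<open>\<open>S\<close> is \<open>T\<close> shifted by one place; the value 0 at k = 0
    keeps all natural numbers as index set.\<close>
  define S where "S n k = (if k = 0 then 0 else T n (k - 1))" for n k
  have loc: "locally_finite (T n) UNIV" for n
    unfolding T_def by (rule locally_finite_gser[OF z0])
  have bij: "bij_betw Suc UNIV {k. k \<noteq> 0}"
    by (rule bij_betwI[where g = "\<lambda>k. k - 1"]) auto
  have gT: "lsum (T n) UNIV = gser z n" for n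
    unfolding gser_def by (rule lsum_cong) (simp add: T_def)
  have S: "lsum (S n) UNIV = gser z n" for n
  proof -
    have "lsum (S n) UNIV = lsum (S n) {k. k \<noteq> 0}"
      by (rule lsum_mono_neutral) (auto simp: S_def)
    also have "\<dots> = lsum (\<lambda>k. S n (Suc k)) UNIV" by (rule lsum_reindex[OF bij])
    also have "\<dots> = lsum (T n) UNIV" by (rule lsum_cong) (simp add: S_def)
    finally show ?thesis by (simp only: gT)
  qed
  have locS: "locally_finite (S n) UNIV" for n
  proof -
    have "locally_finite (S n) {k. k \<noteq> 0}"
      unfolding locally_finite_reindex[OF bij] using loc[of n] by (simp add: S_def)
    moreover have "{k \<in> UNIV. fps_nth (S n k) j \<noteq> 0} = {k \<in> {k. k \<noteq> 0}. fps_nth (S n k) j \<noteq> 0}" for j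
      by (auto simp: S_def)
    ultimately show ?thesis by (simp add: locally_finite_def)
  qed
  have T_rec: "T (n + 1) k = S n k + z ^ (nat ((n + 1 - int k)\<^sup>2) + 2 * k) * qinv k" for n k
  proof (cases k)
    case 0
    then show ?thesis by (simp add: S_def T_def)
  next
    case (Suc i)
    have "z ^ N * qinv (Suc i) = z ^ N * qinv i + z ^ (N + 2 * Suc i) * qinv (Suc i)" for N
      unfolding qinv_Suc[of i, symmetric] power_add zX by (simp add: algebra_simps)
    then show ?thesis by (simp add: Suc S_def T_def)
  qed
  have exponent: "int (nat ((n + 1 - int k)\<^sup>2) + 2 * k) = int (nat ((n - int k)\<^sup>2)) + 2 * n + 1" for n k
    by simp (simp add: power2_eq_square algebra_simps)
  show "gser z (int n + 1) = (1 + z ^ (2 * n + 1)) * gser z (int n)"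
  proof -
    have "T (int n + 1) k = S (int n) k + z ^ (2 * n + 1) * T (int n) k" for k
    proof -
      have "nat ((int n + 1 - int k)\<^sup>2) + 2 * k = 2 * n + 1 + nat ((int n - int k)\<^sup>2)"
        using exponent[of "int n" k] by linarith
      then show ?thesis unfolding T_rec by (simp only: T_def power_add mult.assoc)
    qed
    then have "gser z (int n + 1) = lsum (\<lambda>k. S (int n) k + z ^ (2 * n + 1) * T (int n) k) UNIV"
      unfolding gT[symmetric] by (intro lsum_cong) simp
    also have "\<dots> = gser z (int n) + z ^ (2 * n + 1) * gser z (int n)"
      unfolding lsum_add[OF locS locally_finite_mult_left[OF loc]] lsum_mult_left[OF loc] S gT ..
    finally show ?thesis by (simp add: algebra_simps)
  qed
  show "z ^ (2 * n + 1) * gser z (- int n) = (1 + z ^ (2 * n + 1)) * gser z (- int n - 1)"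
  proof -
    let ?m = "- int n - 1"
    have "z ^ (2 * n + 1) * T (- int n) k = z ^ (2 * n + 1) * S ?m k + T ?m k" for k
    proof -
      have "2 * n + 1 + (a + 2 * k) = b" if "int (a + 2 * k) = int b + 2 * ?m + 1" for a b
        using that by presburger
      from this[OF exponent[of ?m k]]
      have "2 * n + 1 + (nat ((?m + 1 - int k)\<^sup>2) + 2 * k) = nat ((?m - int k)\<^sup>2)" .
      then have "z ^ (2 * n + 1) * z ^ (nat ((?m + 1 - int k)\<^sup>2) + 2 * k) = z ^ nat ((?m - int k)\<^sup>2)"
        by (simp only: power_add[symmetric])
      then show ?thesis
        using T_rec[of ?m k] by (simp add: T_def distrib_left mult.assoc[symmetric])
    qed
    then have "lsum (\<lambda>k. z ^ (2 * n + 1) * T (- int n) k) UNIV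
        = lsum (\<lambda>k. z ^ (2 * n + 1) * S ?m k + T ?m k) UNIV"
      by simp
    also have "\<dots> = z ^ (2 * n + 1) * gser z ?m + gser z ?m"
      unfolding lsum_add[OF locally_finite_mult_left[OF locS] loc] lsum_mult_left[OF locS] S gT ..
    finally show ?thesis
      unfolding lsum_mult_left[OF loc] gT by (simp add: algebra_simps)
  qed
qed

text \<open>For z = q and z = -q the ratios to \<open>gser z 0\<close> are the two finite products
  in the summand of V.\<close>

lemma gser_nonneg:
  assumes "z = fps_X \<or> z = - (fps_X :: int fps)"
  shows "gser z (int n) = qpoch (- z) (z\<^sup>2) n * gser z 0"
proof (induction n)
  case (Suc n)
  have "gser z (int (Suc n)) = (1 + z ^ (2 * n + 1)) * gser z (int n)"
    using gser_step(1)[OF assms, of n] by (simp add: add.commute)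
  then show ?case by (simp add: Suc qpoch_Suc mult_ac flip: power_mult)
qed simp

text \<open>At negative indices the finite product is a denominator, so it is kept on the
  left.\<close>

lemma gser_neg:
  assumes "z = fps_X \<or> z = - (fps_X :: int fps)"
  shows "qpoch (- z) (z\<^sup>2) n * gser z (- int n) = z ^ (n\<^sup>2) * gser z 0"
proof (induction n)
  case (Suc n)
  have n: "- int (Suc n) = - int n - 1" by simp
  have "qpoch (- z) (z\<^sup>2) (Suc n) * gser z (- int (Suc n))
      = qpoch (- z) (z\<^sup>2) n * ((1 + z ^ (2 * n + 1)) * gser z (- int n - 1))"
    unfolding n by (simp add: qpoch_Suc mult_ac flip: power_mult)
  also have "\<dots> = z ^ (2 * n + 1) * (qpoch (- z) (z\<^sup>2) n * gser z (- int n))"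
    unfolding gser_step(2)[OF assms, symmetric] by (simp add: mult_ac)
  also have "\<dots> = z ^ (2 * n + 1 + n\<^sup>2) * gser z 0" by (simp only: Suc power_add mult.assoc)
  also have "2 * n + 1 + n\<^sup>2 = (Suc n)\<^sup>2" by (simp add: power2_eq_square)
  finally show ?case .
qed simp

lemma fps_compose_X_power_inj:
  fixes f g :: "'a::idom fps"
  assumes "f oo fps_X ^ k = g oo fps_X ^ k" "k > 0"
  shows "f = g"
proof (rule fps_ext)
  fix n
  have "fps_nth (f oo fps_X ^ k) (k * n) = fps_nth (g oo fps_X ^ k) (k * n)" using assms by simp
  then show "fps_nth f n = fps_nth g n" using assms(2) by (simp add: fps_nth_compose_X_power)
qed

section \<open>The generating function V as half of a bilateral series\<close>

lemma suminf_eq_lsum: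
  fixes f :: "nat \<Rightarrow> 'a::comm_ring_1 fps"
  assumes "summable f" "locally_finite f UNIV"
  shows "suminf f = lsum f UNIV"
proof (rule fps_ext)
  fix j
  define S where "S = {i \<in> UNIV. fps_nth (f i) j \<noteq> 0}"
  have S: "finite S" using locally_finiteD[OF assms(2)] by (simp add: S_def)
  then obtain M where M: "S \<subseteq> {..<M}" using finite_nat_iff_bounded by blast
  have "(\<lambda>N. \<Sum>n<N. f n) \<longlonglongrightarrow> suminf f" using summable_sums[OF assms(1)] by (simp add: sums_def)
  then have "eventually (\<lambda>N. fps_nth (\<Sum>n<N. f n) j = fps_nth (suminf f) j) sequentially"
    by (simp add: tendsto_fps_iff)
  then obtain N where N: "\<And>n. n \<ge> N \<Longrightarrow> fps_nth (\<Sum>i<n. f i) j = fps_nth (suminf f) j"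
    by (auto simp: eventually_sequentially)
  have "fps_nth (lsum f UNIV) j = (\<Sum>i<max M N. fps_nth (f i) j)"
  proof (rule lsum_nth)
    fix i assume "i \<notin> {..<max M N}"
    then have "i \<notin> S" using M by auto
    then show "fps_nth (f i) j = 0" by (simp add: S_def)
  qed auto
  then show "fps_nth (suminf f) j = fps_nth (lsum f UNIV) j"
    using N[of "max M N"] by (simp add: fps_sum_nth)
qed

lemma locally_finite_v0_term: "locally_finite v0_term UNIV"
proof (rule locally_finiteI[OF v0_term_nth_eq_0])
  fix j :: nat
  have "m \<le> m\<^sup>2" for m :: nat by (simp add: power2_eq_square)
  then have "{m \<in> UNIV. m\<^sup>2 \<le> j} \<subseteq> {..j}" by (auto intro: order_trans)
  then show "finite {m \<in> UNIV. m\<^sup>2 \<le> j}" using finite_subset by blast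
qed

lemma Abs_fps_v0: "Abs_fps v0 = lsum v0_term UNIV"
  unfolding suminf_eq_lsum[OF summable_v0_term locally_finite_v0_term, symmetric]
  by (simp add: fps_eq_iff v0_def)

lemma v0_term_mult: "qpoch fps_X (fps_X\<^sup>2) n * v0_term n = fps_X ^ (n\<^sup>2) * qpoch (- fps_X) (fps_X\<^sup>2) n"
  unfolding v0_term_def using qpoch_mult_inverse[of n] by (simp add: mult_ac)

lemma qpoch_compose:
  assumes "fps_nth (h::'a::idom fps) 0 = 0"
  shows "qpoch a q n oo h = qpoch (a oo h) (q oo h) n"
  by (induction n)
    (simp_all add: qpoch_Suc fps_compose_mult_distrib fps_compose_sub_distrib fps_compose_power assms)

lemma qpoch_X_neq_0: "qpoch z (fps_X\<^sup>2) n \<noteq> 0" if "fps_nth z 0 = 0" for z :: "int fps"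
proof -
  have "fps_nth (qpoch z (fps_X\<^sup>2) n) 0 = 1" by (induction n) (simp_all add: qpoch_Suc that)
  then show ?thesis by auto
qed

text \<open>The summand of V continued to negative n is the summand with -q for q: both are products
  of \<open>gser\<close> values, and the change of sign exchanges the two finite products.\<close>

lemma bilateral_term:
  "(-1) ^ (n\<^sup>2) * (gser fps_X (int n) * gser (- fps_X) (- int n))
     = v0_term n * (gser fps_X 0 * gser (- fps_X) 0)" (is ?A)
  "(-1) ^ (n\<^sup>2) * (gser fps_X (- int n) * gser (- fps_X) (int n))
     = (v0_term n oo - fps_X) * (gser fps_X 0 * gser (- fps_X) 0)" (is ?B)
proof -
  let ?P = "qpoch fps_X (fps_X\<^sup>2) n :: int fps" and ?M = "qpoch (- fps_X) (fps_X\<^sup>2) n :: int fps"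
  have sgn: "(-1) ^ (n\<^sup>2) * (- fps_X) ^ (n\<^sup>2) = (fps_X ^ (n\<^sup>2) :: int fps)"
    by (simp flip: power_mult_distrib)
  have "?P * ((-1) ^ (n\<^sup>2) * (gser fps_X (int n) * gser (- fps_X) (- int n)))
     = (-1) ^ (n\<^sup>2) * gser fps_X (int n) * (qpoch (- (- fps_X)) ((- fps_X)\<^sup>2) n * gser (- fps_X) (- int n))"
    by (simp add: mult_ac)
  also have "\<dots> = (-1) ^ (n\<^sup>2) * (?M * gser fps_X 0) * ((- fps_X) ^ (n\<^sup>2) * gser (- fps_X) 0)"
    by (subst gser_neg, simp, subst gser_nonneg) auto
  also have "\<dots> = ((-1) ^ (n\<^sup>2) * (- fps_X) ^ (n\<^sup>2)) * ?M * (gser fps_X 0 * gser (- fps_X) 0)"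
    by (simp only: mult_ac)
  also have "\<dots> = (?P * v0_term n) * (gser fps_X 0 * gser (- fps_X) 0)"
    by (simp only: sgn v0_term_mult)
  finally have "?P * ((-1) ^ (n\<^sup>2) * (gser fps_X (int n) * gser (- fps_X) (- int n)))
     = ?P * (v0_term n * (gser fps_X 0 * gser (- fps_X) 0))" by (simp only: mult.assoc)
  then show ?A by (subst (asm) mult_left_cancel) (simp_all add: qpoch_X_neq_0)
  have comp: "?M * (v0_term n oo - fps_X) = (- fps_X) ^ (n\<^sup>2) * ?P"
  proof -
    have "(?P * v0_term n) oo - fps_X = (fps_X ^ (n\<^sup>2) * ?M) oo - fps_X" by (simp only: v0_term_mult)
    then show ?thesis
      by (simp add: fps_compose_mult_distrib qpoch_compose fps_X_power_compose fps_compose_uminus)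
  qed
  have "?M * ((-1) ^ (n\<^sup>2) * (gser fps_X (- int n) * gser (- fps_X) (int n)))
     = (-1) ^ (n\<^sup>2) * (?M * gser fps_X (- int n)) * gser (- fps_X) (int n)"
    by (simp only: mult_ac)
  also have "\<dots> = (-1) ^ (n\<^sup>2) * (fps_X ^ (n\<^sup>2) * gser fps_X 0) * (?P * gser (- fps_X) 0)"
    by (subst gser_neg, simp, subst gser_nonneg) auto
  also have "\<dots> = ((-1) ^ (n\<^sup>2) * fps_X ^ (n\<^sup>2)) * ?P * (gser fps_X 0 * gser (- fps_X) 0)"
    by (simp only: mult_ac)
  also have "\<dots> = (?M * (v0_term n oo - fps_X)) * (gser fps_X 0 * gser (- fps_X) 0)"
    unfolding comp by (simp flip: power_mult_distrib)
  finally have "?M * ((-1) ^ (n\<^sup>2) * (gser fps_X (- int n) * gser (- fps_X) (int n)))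
     = ?M * ((v0_term n oo - fps_X) * (gser fps_X 0 * gser (- fps_X) 0))" by (simp only: mult.assoc)
  then show ?B by (subst (asm) mult_left_cancel) (simp_all add: qpoch_X_neq_0)
qed

text \<open>Splitting the bilateral sum at n = 0 yields V(q) and V(-q); the shared term is 1 and is
  subtracted once. The sum is evaluated by \<open>bilateral_sum\<close> with z1 = q and z2 = -q, so
  that y = q^2.\<close>

lemma v0_bilateral:
  "gser fps_X 0 * gser (- fps_X) 0 * (Abs_fps v0 + (Abs_fps v0 oo - fps_X) - 1)
     = theta (fps_X\<^sup>2) * (gser fps_X 0 oo fps_X\<^sup>2)"
proof -
  define F where "F n = (if n \<ge> 0 then v0_term (nat n) else v0_term (nat (- n)) oo - fps_X)" for n :: int
  define G where "G = gser fps_X 0 * gser (- fps_X) 0"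
  have summand: "(-1) ^ nat (n\<^sup>2) * (gser fps_X n * gser (- fps_X) (- n)) = G * F n" for n
  proof (cases "n \<ge> 0")
    case True
    then obtain m where "n = int m" by (metis nonneg_int_cases)
    then show ?thesis using bilateral_term(1)[of m] by (simp add: F_def G_def nat_power_eq mult_ac)
  next
    case False
    then obtain m where "n = - int m" "m > 0" by (metis linorder_not_le neg_int_cases)
    then show ?thesis using bilateral_term(2)[of m] by (simp add: F_def G_def nat_power_eq mult_ac)
  qed
  have locF: "locally_finite F UNIV"
  proof (rule locally_finiteI)
    fix n :: int and j assume "j < nat (n\<^sup>2)"
    then show "fps_nth (F n) j = 0"
      by (simp add: F_def nat_power_eq fps_compose_uminus' v0_term_nth_eq_0 flip: nat_power_eq)
  next
    fix j
    have "{n \<in> UNIV. nat (n\<^sup>2) \<le> j} \<subseteq> {- int j..int j}"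
      using nat_square_le_imp_abs_le by (force simp: abs_le_iff)
    then show "finite {n::int \<in> UNIV. nat (n\<^sup>2) \<le> j}" using finite_subset by blast
  qed
  have "lsum F UNIV = lsum F ({0..} \<union> {..<0})"
    by (rule arg_cong[of _ _ "lsum F"]) auto
  also have "\<dots> = lsum F {0..} + lsum F {..<0}"
    by (rule lsum_Un) (use locally_finite_subset[OF locF] in auto)
  also have "lsum F {0..} = lsum v0_term UNIV"
  proof -
    have "bij_betw int UNIV {0..}" by (rule bij_betwI[where g = nat]) auto
    from lsum_reindex[OF this, of F] show ?thesis by (simp add: F_def)
  qed
  also have "lsum F {..<0} = (Abs_fps v0 oo - fps_X) - 1"
  proof -
    have "bij_betw (\<lambda>m. - int m) {0<..} {..<0}"
      by (rule bij_betwI[where g = "\<lambda>n. nat (- n)"]) auto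
    then have "lsum F {..<0} = lsum (\<lambda>m. F (- int m)) {0<..}" by (rule lsum_reindex)
    also have "\<dots> = lsum (\<lambda>m. v0_term m oo - fps_X) {0<..}"
      by (rule lsum_cong) (simp add: F_def)
    finally have *: "lsum F {..<0} = lsum (\<lambda>m. v0_term m oo - fps_X) {0<..}" .
    have loc: "locally_finite (\<lambda>m. v0_term m oo - fps_X) UNIV"
      using locally_finite_v0_term by (simp add: locally_finite_def fps_compose_uminus')
    have "Abs_fps v0 oo - fps_X = lsum (\<lambda>m. v0_term m oo - fps_X) UNIV"
      unfolding Abs_fps_v0 by (rule lsum_compose[OF locally_finite_v0_term])
    also have "\<dots> = lsum (\<lambda>m. v0_term m oo - fps_X) ({0} \<union> {0<..})"
      by (rule arg_cong[of _ _ "lsum (\<lambda>m. v0_term m oo - fps_X)"]) auto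
    also have "\<dots> = lsum (\<lambda>m. v0_term m oo - fps_X) {0} + lsum (\<lambda>m. v0_term m oo - fps_X) {0<..}"
      by (rule lsum_Un) (use locally_finite_subset[OF loc] in auto)
    also have "lsum (\<lambda>m. v0_term m oo - fps_X) {0} = 1"
      using qpoch_mult_inverse[of 0] by (simp add: lsum_finite v0_term_def)
    finally show ?thesis by (simp add: *)
  qed
  finally have "lsum F UNIV = Abs_fps v0 + (Abs_fps v0 oo - fps_X) - 1"
    by (simp add: Abs_fps_v0)
  then have "G * (Abs_fps v0 + (Abs_fps v0 oo - fps_X) - 1) = lsum (\<lambda>n. G * F n) UNIV"
    by (simp add: lsum_mult_left[OF locF])
  also have "\<dots> = theta (fps_X\<^sup>2) * (gser fps_X 0 oo fps_X\<^sup>2)"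
    using bilateral_sum[of fps_X "- fps_X"]
    by (simp add: summand gser_compose_square(1) flip: power2_eq_square)
  finally show ?thesis by (simp add: G_def)
qed

text \<open>The case z1 = z2 = z of \<open>bilateral_sum\<close>: the product of
  \<open>gser z n\<close> and \<open>gser z (- n)\<close> is z^(n^2) times a series independent of
  n, so the left side collapses to a theta function.\<close>

lemma theta_gser:
  assumes "z = fps_X \<or> z = - (fps_X :: int fps)"
  shows "theta (- z) * (gser z 0)\<^sup>2 = theta (- (fps_X\<^sup>2)) * (gser (- fps_X) 0 oo fps_X\<^sup>2)"
proof -
  have pos: "gser z (int m) * gser z (- int m) = z ^ (m\<^sup>2) * (gser z 0)\<^sup>2" for m
    using gser_neg[OF assms, of m] gser_nonneg[OF assms, of m]
    by (simp add: power2_eq_square mult_ac)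
  have "gser z n * gser z (- n) = z ^ nat (n\<^sup>2) * (gser z 0)\<^sup>2" for n
  proof (cases "n \<ge> 0")
    case True
    then obtain m where "n = int m" by (metis nonneg_int_cases)
    then show ?thesis using pos[of m] by (simp add: nat_power_eq)
  next
    case False
    then obtain m where "n = - int m" by (metis linorder_not_le neg_int_cases)
    then show ?thesis using pos[of m] by (simp add: nat_power_eq mult.commute)
  qed
  then have "(-1) ^ nat (n\<^sup>2) * (gser z n * gser z (- n)) = (gser z 0)\<^sup>2 * (- z) ^ nat (n\<^sup>2)" for n
    by (simp add: power_minus[of z] mult_ac)
  then have "theta (- z) * (gser z 0)\<^sup>2 = lsum (\<lambda>n::int. (-1) ^ nat (n\<^sup>2) * (gser z n * gser z (- n))) UNIV"
    using lsum_mult_left[OF locally_finite_theta, of "- z" "(gser z 0)\<^sup>2"] assms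
    by (auto simp: theta_def mult_ac)
  also have "- z * z = - (fps_X\<^sup>2)" using assms by (auto simp: power2_eq_square)
  then have "lsum (\<lambda>n::int. (-1) ^ nat (n\<^sup>2) * (gser z n * gser z (- n))) UNIV
     = theta (- (fps_X\<^sup>2)) * (gser (- fps_X) 0 oo fps_X\<^sup>2)"
    using bilateral_sum[OF assms assms] by (simp only: gser_compose_square(2))
  finally show ?thesis .
qed

section \<open>Theta functions\<close>

lemma theta_compose:
  assumes "fps_nth z 0 = 0" "fps_nth h 0 = 0"
  shows "theta z oo h = theta (z oo h)"
  unfolding theta_def lsum_compose[OF locally_finite_theta[OF assms(1)]]
  by (simp add: fps_compose_power assms(2))

lemma theta_nth_0 [simp]:
  assumes "fps_nth z 0 = 0"
  shows "fps_nth (theta z) 0 = 1"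
  unfolding theta_def
  by (subst lsum_nth[of "{0}"]) (auto simp: assms startsby_zero_power zero_less_power2)

lemma gser_nth_0 [simp]:
  assumes "fps_nth z 0 = 0"
  shows "fps_nth (gser z 0) 0 = 1"
proof -
  have "fps_nth (gser z 0) 0 = (\<Sum>k\<in>{0}. fps_nth (z ^ nat ((0 - int k)\<^sup>2) * qinv k) 0)"
    unfolding gser_def by (rule lsum_nth) (auto intro!: fps_nth_power_mult_eq_0 assms)
  then show ?thesis by simp
qed

text \<open>The substitution m = c - d, n = c + d covers exactly the pairs with m + n even and gives
  the square; the other pairs are kept as a sum that cancels in the applications.\<close>

lemma theta_mult_split:
  assumes "a = fps_X \<or> a = - fps_X" "b = fps_X \<or> b = - (fps_X :: int fps)"
  shows "theta a * theta b = (theta (a * b))\<^sup>2 +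
     lsum (\<lambda>(m, n). a ^ nat (m\<^sup>2) * b ^ nat (n\<^sup>2)) {(m, n). odd (m + n)}"
proof -
  define f where "f = (\<lambda>(m::int, n::int). a ^ nat (m\<^sup>2) * b ^ nat (n\<^sup>2))"
  have 0: "fps_nth a 0 = 0" "fps_nth b 0 = 0" "fps_nth (a * b) 0 = 0" using assms by auto
  have loc: "locally_finite f (UNIV \<times> UNIV)"
    unfolding f_def by (intro locally_finite_times locally_finite_theta 0)
  have bij: "bij_betw (\<lambda>(c, d). (c - d, c + d)) (UNIV \<times> UNIV) {(m::int, n). even (m + n)}"
    by (rule bij_betwI[where g = "\<lambda>(m, n). ((m + n) div 2, (n - m) div 2)"]) (auto, presburger+)
  have "theta a * theta b = lsum f (UNIV \<times> UNIV)"
    unfolding theta_def f_def by (intro lsum_times locally_finite_theta 0)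
  also have "UNIV \<times> UNIV = {(m::int, n). even (m + n)} \<union> {(m, n). odd (m + n)}" by auto
  also have "lsum f \<dots> = lsum f {(m, n). even (m + n)} + lsum f {(m, n). odd (m + n)}"
    by (rule lsum_Un) (use locally_finite_subset[OF loc] in auto)
  also have "lsum f {(m, n). even (m + n)} = lsum (\<lambda>(c, d). f (c - d, c + d)) (UNIV \<times> UNIV)"
    unfolding lsum_reindex[OF bij] by (simp add: case_prod_unfold)
  also have "\<dots> = lsum (\<lambda>(c, d). (a * b) ^ nat (c\<^sup>2) * (a * b) ^ nat (d\<^sup>2)) (UNIV \<times> UNIV)"
    by (simp add: f_def power_nat_squares[OF assms])
  also have "\<dots> = theta (a * b) * theta (a * b)"
    unfolding theta_def by (intro lsum_times[symmetric] locally_finite_theta 0)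
  finally show ?thesis by (simp add: f_def power2_eq_square)
qed

lemma locally_finite_theta_pair:
  assumes "fps_nth a 0 = 0" "fps_nth (b :: int fps) 0 = 0"
  shows "locally_finite (\<lambda>(m::int, n::int). a ^ nat (m\<^sup>2) * b ^ nat (n\<^sup>2)) I"
  by (rule locally_finite_subset[OF locally_finite_times[OF
        locally_finite_theta[OF assms(1)] locally_finite_theta[OF assms(2)]]]) auto

text \<open>Exchanging m and n reverses the sign of every term with m + n odd, since exactly one of
  m and n is odd; that part vanishes.\<close>

lemma theta_mult_theta_neg: "theta fps_X * theta (- fps_X) = (theta (- (fps_X\<^sup>2)))\<^sup>2"
proof -
  let ?O = "{(m::int, n::int). odd (m + n)}"
  define f where "f = (\<lambda>(m::int, n::int). fps_X ^ nat (m\<^sup>2) * (- fps_X :: int fps) ^ nat (n\<^sup>2))"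
  have bij: "bij_betw prod.swap ?O ?O"
    by (rule bij_betwI[where g = prod.swap]) (auto simp: add.commute)
  have "lsum f ?O = lsum (\<lambda>p. f (prod.swap p)) ?O" by (rule lsum_reindex[OF bij])
  also have "\<dots> = lsum (\<lambda>p. - 1 * f p) ?O"
  proof (rule lsum_cong)
    fix p assume "p \<in> ?O"
    then obtain m n where p: "p = (m, n)" "odd (m + n)" by auto
    have "odd (nat (m\<^sup>2)) \<longleftrightarrow> even (nat (n\<^sup>2))" using p(2) by (simp add: even_nat_iff)
    then show "f (prod.swap p) = - 1 * f p"
      by (cases "even (nat (n\<^sup>2))") (simp_all add: f_def p(1))
  qed
  also have "\<dots> = - lsum f ?O"
    by (subst lsum_mult_left) (auto simp: f_def intro: locally_finite_theta_pair)
  finally have "lsum f ?O = 0" by simp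
  then show ?thesis
    using theta_mult_split[of fps_X "- fps_X"] by (simp add: f_def flip: power2_eq_square)
qed

text \<open>Replacing q by -q negates precisely the terms with m + n odd, so they cancel.\<close>

lemma theta_square_add: "(theta fps_X)\<^sup>2 + (theta (- fps_X))\<^sup>2 = 2 * (theta (fps_X\<^sup>2))\<^sup>2"
proof -
  let ?O = "{(m::int, n::int). odd (m + n)}"
  define f where "f z = (\<lambda>(m::int, n::int). z ^ nat (m\<^sup>2) * z ^ nat (n\<^sup>2))" for z :: "int fps"
  have "f (- fps_X) p = - 1 * f fps_X p" if "p \<in> ?O" for p
  proof -
    obtain m n where p: "p = (m, n)" "odd (m + n)" using \<open>p \<in> ?O\<close> by auto
    have "odd (nat (m\<^sup>2)) \<longleftrightarrow> even (nat (n\<^sup>2))" using p(2) by (simp add: even_nat_iff)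
    then show ?thesis by (cases "even (nat (n\<^sup>2))") (simp_all add: f_def p(1))
  qed
  then have "lsum (f (- fps_X)) ?O = lsum (\<lambda>p. - 1 * f fps_X p) ?O" by (rule lsum_cong)
  also have "\<dots> = - lsum (f fps_X) ?O"
    by (subst lsum_mult_left) (auto simp: f_def intro: locally_finite_theta_pair)
  finally show ?thesis
    using theta_mult_split[of fps_X fps_X] theta_mult_split[of "- fps_X" "- fps_X"]
    by (simp add: f_def flip: power2_eq_square)
qed

text \<open>In product form \<open>gser fps_X 0\<close> is (-q;q^2)_\<infinity> and
  \<open>gser (- fps_X) 0\<close> is (q;q^2)_\<infinity>. The squares of both sides agree by
  \<open>theta_gser\<close> and \<open>theta_mult_theta_neg\<close>, and constant term 1 selects the
  sign of the root.\<close>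

lemma theta_quotient_gser:
  shows "theta (- (fps_X\<^sup>2)) * gser fps_X 0 = theta fps_X * gser (- fps_X) 0"
    and "gser fps_X 0 * gser (- fps_X) 0 = gser (- fps_X) 0 oo fps_X\<^sup>2"
proof -
  define t t' T' g g' G' where defs: "t = theta fps_X" "t' = theta (- fps_X)" "T' = theta (- (fps_X\<^sup>2))"
    "g = gser fps_X 0" "g' = gser (- fps_X) 0" "G' = gser (- fps_X) 0 oo (fps_X\<^sup>2 :: int fps)"
  have nth0: "fps_nth t 0 = 1" "fps_nth t' 0 = 1" "fps_nth T' 0 = 1" "fps_nth g 0 = 1"
    "fps_nth g' 0 = 1" "fps_nth G' 0 = 1"
    by (simp_all add: defs)
  have square_cancel: "x = y" if "x\<^sup>2 = y\<^sup>2" "fps_nth x 0 = 1" "fps_nth y 0 = 1" for x y :: "int fps"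
    using that by (auto simp: power2_eq_iff)
  have a: "t' * g\<^sup>2 = T' * G'" and b: "t * g'\<^sup>2 = T' * G'"
    using theta_gser[of fps_X] theta_gser[of "- fps_X"] by (simp_all add: defs)
  have c: "t * t' = T'\<^sup>2" using theta_mult_theta_neg by (simp add: defs)
  have "(T' * g)\<^sup>2 = t * (t' * g\<^sup>2)" by (simp add: power_mult_distrib mult.assoc flip: c)
  also have "\<dots> = (t * g')\<^sup>2" unfolding a b[symmetric] by (simp add: power2_eq_square mult_ac)
  finally show "theta (- (fps_X\<^sup>2)) * gser fps_X 0 = theta fps_X * gser (- fps_X) 0"
    using square_cancel[of "T' * g" "t * g'"] nth0 by (simp add: defs)
  have "(T' * (g * g'))\<^sup>2 = (t' * g\<^sup>2) * (t * g'\<^sup>2)"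
    by (simp add: power_mult_distrib mult_ac flip: c)
  also have "\<dots> = (T' * G')\<^sup>2" unfolding a b by (simp add: power2_eq_square)
  finally have "T' * (g * g') = T' * G'"
    by (rule square_cancel) (simp_all add: nth0)
  then have "g * g' = G'" using nth0(3) by auto
  then show "gser fps_X 0 * gser (- fps_X) 0 = gser (- fps_X) 0 oo fps_X\<^sup>2" by (simp add: defs)
qed

definition v0_quarter :: "int fps" where
  "v0_quarter = Abs_fps (\<lambda>n. 2 * v0 (4 * n) - (if n = 0 then 1 else 0))"

text \<open>Cancelling the \<open>gser\<close> factors in \<open>v0_bilateral\<close> gives
  \<phi>(-q^4) W = \<phi>(q^2)^2, a relation in q^2. After q^2 is replaced by q, adding the same
  relation at -q isolates the values v0(4n), and \<open>theta_square_add\<close> evaluates the right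
  side.\<close>

lemma theta_neg_mult_v0_quarter: "theta (- fps_X) * v0_quarter = (theta fps_X)\<^sup>2"
proof -
  define W where "W = Abs_fps v0 + (Abs_fps v0 oo - fps_X) - 1"
  define W1 where "W1 = Abs_fps (\<lambda>n. 2 * v0 (2 * n) - (if n = 0 then 1 else 0))"
  define G where "G = gser fps_X 0 oo (fps_X\<^sup>2 :: int fps)"
  define G' where "G' = gser (- fps_X) 0 oo (fps_X\<^sup>2 :: int fps)"
  have W: "W = W1 oo fps_X ^ 2"
    by (rule fps_ext) (auto simp: W_def W1_def fps_nth_compose_X_power fps_compose_uminus' elim!: evenE)
  have "(theta (- (fps_X\<^sup>2)) * gser fps_X 0) oo fps_X\<^sup>2 = (theta fps_X * gser (- fps_X) 0) oo fps_X\<^sup>2"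
    by (simp only: theta_quotient_gser(1))
  then have quot: "(theta (- (fps_X\<^sup>2)) oo fps_X\<^sup>2) * G = theta (fps_X\<^sup>2) * G'"
    by (simp add: fps_compose_mult_distrib G_def G'_def theta_compose)
  have "G' * W = theta (fps_X\<^sup>2) * G"
    using v0_bilateral by (simp only: theta_quotient_gser(2) W_def G_def G'_def)
  then have "(theta (- (fps_X\<^sup>2)) oo fps_X\<^sup>2) * (G' * W)
      = theta (fps_X\<^sup>2) * ((theta (- (fps_X\<^sup>2)) oo fps_X\<^sup>2) * G)"
    by (simp only: mult.left_commute)
  then have "(theta (- (fps_X\<^sup>2)) oo fps_X\<^sup>2) * (G' * W) = theta (fps_X\<^sup>2) * (theta (fps_X\<^sup>2) * G')"
    by (simp only: quot)
  then have "G' * ((theta (- (fps_X\<^sup>2)) oo fps_X\<^sup>2) * W) = G' * (theta (fps_X\<^sup>2))\<^sup>2"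
    by (simp only: power2_eq_square mult_ac)
  moreover have "fps_nth G' 0 = 1" by (simp add: G'_def)
  ultimately have "(theta (- (fps_X\<^sup>2)) oo fps_X\<^sup>2) * W = (theta (fps_X\<^sup>2))\<^sup>2" by auto
  then have "(theta (- (fps_X\<^sup>2)) * W1) oo fps_X ^ 2 = (theta fps_X)\<^sup>2 oo fps_X ^ 2"
    by (simp add: W fps_compose_mult_distrib theta_compose flip: fps_compose_power)
  then have 1: "theta (- (fps_X\<^sup>2)) * W1 = (theta fps_X)\<^sup>2"
    by (rule fps_compose_X_power_inj) simp
  then have "(theta (- (fps_X\<^sup>2)) * W1) oo - fps_X = (theta fps_X)\<^sup>2 oo - fps_X" by simp
  then have 2: "theta (- (fps_X\<^sup>2)) * (W1 oo - fps_X) = (theta (- fps_X))\<^sup>2"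
    by (simp add: fps_compose_mult_distrib theta_compose fps_compose_uminus fps_X_power_compose
        flip: fps_compose_power)
  have "W1 + (W1 oo - fps_X) = 2 * (v0_quarter oo fps_X ^ 2)"
    by (rule fps_ext)
      (auto simp: v0_quarter_def W1_def fps_nth_compose_X_power fps_compose_uminus' mult.assoc[of 2, symmetric]
        numeral_fps_const elim!: evenE)
  then have "2 * (theta (- (fps_X\<^sup>2)) * (v0_quarter oo fps_X ^ 2)) = theta (- (fps_X\<^sup>2)) * (W1 + (W1 oo - fps_X))"
    by simp
  also have "\<dots> = 2 * (theta (fps_X\<^sup>2))\<^sup>2"
    unfolding distrib_left 1 2 by (rule theta_square_add)
  finally have "(theta (- fps_X) * v0_quarter) oo fps_X ^ 2 = (theta fps_X)\<^sup>2 oo fps_X ^ 2"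
    by (simp add: fps_compose_mult_distrib theta_compose fps_compose_uminus flip: fps_compose_power)
  then show ?thesis by (rule fps_compose_X_power_inj) simp
qed

section \<open>Dissection modulo 4\<close>

definition psi :: "int fps" where
  "psi = lsum (\<lambda>k. fps_X ^ (k * (k + 1) div 2)) UNIV"

lemma locally_finite_psi: "locally_finite (\<lambda>k. fps_X ^ (k * (k + 1) div 2) :: int fps) UNIV"
proof (rule locally_finiteI)
  fix j :: nat
  have "k \<le> k * (k + 1) div 2" for k :: nat by (induction k) auto
  then have "{k \<in> UNIV. k * (k + 1) div 2 \<le> j} \<subseteq> {..j}" by (auto intro: order_trans)
  then show "finite {k \<in> UNIV. k * (k + 1) div 2 \<le> j}" using finite_subset by blast
qed simp

lemma psi_nth_nontriangular:
  assumes "\<nexists>k. n = k * (k + 1) div 2"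
  shows "fps_nth psi n = 0"
  unfolding psi_def by (subst lsum_nth[of "{}"]) (use assms in auto)

lemma odd_square_eq: "(2 * k + 1)\<^sup>2 = 8 * (k * (k + 1) div 2) + (1::nat)"
proof -
  define T where "T = k * (k + 1) div 2"
  have "2 * T = k * (k + 1)" by (simp add: T_def)
  moreover have "(2 * k + 1)\<^sup>2 = 4 * (k * (k + 1)) + 1" by (simp add: power2_eq_square algebra_simps)
  ultimately show ?thesis unfolding T_def[symmetric] by linarith
qed

text \<open>A contribution would require 8n + 1 = m^2, but odd squares have the form 8T + 1 with T
  triangular.\<close>

lemma theta_X_nth_nontriangular:
  assumes "\<nexists>k. n = k * (k + 1) div 2"
  shows "fps_nth (theta fps_X) (8 * n + 1) = 0"
  unfolding theta_def
proof (subst lsum_nth[of "{}"]; simp)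
  fix m :: int
  show "Suc (8 * n) \<noteq> nat (m\<^sup>2)"
  proof
    assume "Suc (8 * n) = nat (m\<^sup>2)"
    then have *: "8 * n + 1 = (nat \<bar>m\<bar>)\<^sup>2"
      by (metis Suc_eq_plus1 abs_ge_zero nat_power_eq power2_abs)
    have "odd (8 * n + 1)" by simp
    then have "odd ((nat \<bar>m\<bar>)\<^sup>2)" unfolding * .
    then have "odd (nat \<bar>m\<bar>)" by simp
    then obtain k where "nat \<bar>m\<bar> = 2 * k + 1" by (rule oddE)
    then have "n = k * (k + 1) div 2" using * odd_square_eq[of k] by simp
    then show False using assms by blast
  qed
qed

text \<open>Even integers contribute \<phi>(q^4). The odd integers 2k+1 and -(2k+1) each contribute
  q^(8T+1) with T = k(k+1)/2.\<close>

lemma theta_dissection: "theta fps_X = (theta fps_X oo fps_X ^ 4) + 2 * fps_X * (psi oo fps_X ^ 8)"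
proof -
  define f where "f n = (fps_X :: int fps) ^ nat (n\<^sup>2)" for n :: int
  have loc: "locally_finite f UNIV"
    unfolding f_def by (rule locally_finite_theta) simp
  have odd_part: "fps_X * (psi oo fps_X ^ 8) = lsum (\<lambda>k. fps_X ^ ((2 * k + 1)\<^sup>2)) UNIV"
  proof -
    have "fps_X * (psi oo fps_X ^ 8) = fps_X * lsum (\<lambda>k. (fps_X ^ (k * (k + 1) div 2)) oo (fps_X ^ 8)) UNIV"
      unfolding psi_def by (simp only: lsum_compose[OF locally_finite_psi])
    also have "\<dots> = lsum (\<lambda>k. fps_X * ((fps_X ^ (k * (k + 1) div 2)) oo (fps_X ^ 8))) UNIV"
    proof (rule lsum_mult_left[symmetric])
      show "locally_finite (\<lambda>k. fps_X ^ (k * (k + 1) div 2) oo (fps_X ^ 8 :: int fps)) UNIV"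
        unfolding locally_finite_def
      proof
        fix j
        have "{k \<in> UNIV. fps_nth (fps_X ^ (k * (k + 1) div 2) oo (fps_X ^ 8 :: int fps)) j \<noteq> 0}
          \<subseteq> {k \<in> UNIV. fps_nth (fps_X ^ (k * (k + 1) div 2) :: int fps) (j div 8) \<noteq> 0}"
          by (auto simp: fps_nth_compose_X_power split: if_splits)
        then show "finite {k \<in> UNIV. fps_nth (fps_X ^ (k * (k + 1) div 2) oo (fps_X ^ 8 :: int fps)) j \<noteq> 0}"
          using locally_finiteD[OF locally_finite_psi] finite_subset by blast
      qed
    qed
    also have "\<dots> = lsum (\<lambda>k. fps_X ^ ((2 * k + 1)\<^sup>2)) UNIV"
      unfolding odd_square_eq
      by (rule lsum_cong, subst fps_X_power_compose) (simp_all add: power_add power_mult mult.commute)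
    finally show ?thesis .
  qed
  have "theta fps_X = lsum f ({n. even n} \<union> ({n. odd n \<and> n > 0} \<union> {n. odd n \<and> n < 0}))"
    unfolding theta_def f_def[symmetric]
    by (rule arg_cong[of _ _ "lsum f"]) (auto simp: not_less_iff_gr_or_eq)
  also have "\<dots> = lsum f {n. even n} + (lsum f {n. odd n \<and> n > 0} + lsum f {n. odd n \<and> n < 0})"
  proof -
    have "lsum f ({n. odd n \<and> n > 0} \<union> {n. odd n \<and> n < 0})
        = lsum f {n. odd n \<and> n > 0} + lsum f {n. odd n \<and> n < 0}"
      by (rule lsum_Un) (use locally_finite_subset[OF loc] in auto)
    moreover have "lsum f ({n. even n} \<union> ({n. odd n \<and> n > 0} \<union> {n. odd n \<and> n < 0}))
        = lsum f {n. even n} + lsum f ({n. odd n \<and> n > 0} \<union> {n. odd n \<and> n < 0})"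
      by (rule lsum_Un) (use locally_finite_subset[OF loc] in auto)
    ultimately show ?thesis by simp
  qed
  also have "lsum f {n. even n} = theta fps_X oo fps_X ^ 4"
  proof -
    have "bij_betw (\<lambda>n. 2 * n) UNIV {n::int. even n}"
      by (rule bij_betwI[where g = "\<lambda>n. n div 2"]) auto
    then have "lsum f {n. even n} = lsum (\<lambda>n. f (2 * n)) UNIV" by (rule lsum_reindex)
    also have "\<dots> = theta (fps_X ^ 4)"
      by (simp add: f_def theta_def power_mult_distrib nat_mult_distrib power_mult)
    finally show ?thesis by (simp add: theta_compose)
  qed
  also have "lsum f {n. odd n \<and> n > 0} = fps_X * (psi oo fps_X ^ 8)"
  proof -
    have "bij_betw (\<lambda>k. 2 * int k + 1) UNIV {n. odd n \<and> n > 0}"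
      by (rule bij_betwI[where g = "\<lambda>n. nat (n div 2)"]) auto
    then have "lsum f {n. odd n \<and> n > 0} = lsum (\<lambda>k. f (2 * int k + 1)) UNIV" by (rule lsum_reindex)
    moreover have "f (2 * int k + 1) = fps_X ^ ((2 * k + 1)\<^sup>2)" for k
    proof -
      have "nat ((2 * int k + 1)\<^sup>2) = (2 * k + 1)\<^sup>2" by (simp add: nat_power_eq nat_add_distrib nat_mult_distrib)
      then show ?thesis by (simp only: f_def)
    qed
    ultimately show ?thesis by (simp only: odd_part)
  qed
  also have "lsum f {n. odd n \<and> n < 0} = fps_X * (psi oo fps_X ^ 8)"
  proof -
    have "bij_betw (\<lambda>k. - (2 * int k + 1)) UNIV {n. odd n \<and> n < 0}"
      by (rule bij_betwI[where g = "\<lambda>n. nat ((- n) div 2)"]) auto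
    then have "lsum f {n. odd n \<and> n < 0} = lsum (\<lambda>k. f (- (2 * int k + 1))) UNIV" by (rule lsum_reindex)
    moreover have "f (- (2 * int k + 1)) = fps_X ^ ((2 * k + 1)\<^sup>2)" for k
    proof -
      have "nat ((- (2 * int k + 1))\<^sup>2) = (2 * k + 1)\<^sup>2"
        unfolding power2_minus by (simp add: nat_power_eq nat_add_distrib nat_mult_distrib)
      then show ?thesis by (simp only: f_def)
    qed
    ultimately show ?thesis by (simp only: odd_part)
  qed
  finally show ?thesis by (simp add: mult.assoc)
qed

lemma compose_X_power_even_minus:
  fixes f :: "'a::idom fps"
  assumes "even k" "k > 0"
  shows "f oo fps_X ^ k oo - fps_X = f oo fps_X ^ k"
  by (rule fps_ext) (use assms in \<open>auto simp: fps_compose_uminus' fps_nth_compose_X_power elim!: evenE\<close>)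

definition theta_even :: "int fps" where "theta_even = theta fps_X oo fps_X ^ 4"
definition theta_odd :: "int fps" where "theta_odd = 2 * fps_X * (psi oo fps_X ^ 8)"

lemma theta_eq_even_plus_odd: "theta fps_X = theta_even + theta_odd"
  using theta_dissection by (simp only: theta_even_def theta_odd_def)

lemma theta_neg_eq_even_minus_odd: "theta (- fps_X) = theta_even - theta_odd"
proof -
  have "theta (- fps_X) = theta fps_X oo - fps_X" by (simp add: theta_compose)
  also have "\<dots> = theta_even - theta_odd"
    by (subst theta_dissection)
      (simp add: theta_even_def theta_odd_def fps_compose_add_distrib fps_compose_mult_distrib compose_X_power_even_minus)
  finally show ?thesis .
qed

text \<open>By \<open>theta_mult_theta_neg\<close> at q^2, \<phi>(-q^4)^4 is the product of
  \<phi>(q^2)^2 and \<phi>(-q^2)^2, which are the sum and the difference of the squares of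
  \<open>theta_even\<close> and \<open>theta_odd\<close>.\<close>

lemma jacobi_compose: "(theta (- fps_X) oo fps_X ^ 4) ^ 4 = theta_even ^ 4 - theta_odd ^ 4"
proof -
  have "(theta fps_X * theta (- fps_X)) oo fps_X\<^sup>2 = (theta (- (fps_X\<^sup>2)))\<^sup>2 oo fps_X\<^sup>2"
    by (simp only: theta_mult_theta_neg)
  then have "theta (fps_X\<^sup>2) * theta (- (fps_X\<^sup>2)) = (theta (- fps_X) oo fps_X ^ 4)\<^sup>2"
    by (simp add: fps_compose_mult_distrib theta_compose fps_compose_uminus fps_X_power_compose
        flip: fps_compose_power power_mult)
  then have "(theta (- fps_X) oo fps_X ^ 4) ^ 4 = (theta (fps_X\<^sup>2))\<^sup>2 * (theta (- (fps_X\<^sup>2)))\<^sup>2"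
    by (metis mult_2_right numeral_Bit0 power_mult power_mult_distrib)
  also have "(theta (fps_X\<^sup>2))\<^sup>2 = theta_even\<^sup>2 + theta_odd\<^sup>2"
  proof -
    have "2 * (theta (fps_X\<^sup>2))\<^sup>2 = 2 * (theta_even\<^sup>2 + theta_odd\<^sup>2)"
      unfolding theta_square_add[symmetric] theta_eq_even_plus_odd theta_neg_eq_even_minus_odd
      by (simp add: power2_eq_square algebra_simps)
    then show ?thesis by (metis mult_left_cancel zero_neq_numeral)
  qed
  also have "(theta (- (fps_X\<^sup>2)))\<^sup>2 = theta_even\<^sup>2 - theta_odd\<^sup>2"
    using theta_mult_theta_neg
    by (simp add: theta_eq_even_plus_odd theta_neg_eq_even_minus_odd power2_eq_square algebra_simps)
  finally show ?thesis by (simp add: algebra_simps power4_eq_xxxx power2_eq_square)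
qed

text \<open>Since \<open>theta_odd ^ 4\<close> is 16 q^4 \<psi>(q^8)^4,
  \<open>jacobi_compose\<close> is this identity of Jacobi with q^4 for q, and that substitution is
  injective.\<close>

lemma jacobi: "(theta fps_X) ^ 4 - (theta (- fps_X)) ^ 4 = 16 * fps_X * (psi oo fps_X\<^sup>2) ^ 4"
proof -
  have "((theta (- fps_X)) ^ 4 + 16 * fps_X * (psi oo fps_X\<^sup>2) ^ 4) oo fps_X ^ 4 = (theta fps_X) ^ 4 oo fps_X ^ 4"
  proof -
    have "(psi oo fps_X\<^sup>2) oo fps_X ^ 4 = psi oo (fps_X ^ 8 :: int fps)"
      by (subst fps_compose_assoc[symmetric]) (simp_all add: fps_X_power_compose flip: power_mult)
    then have "((theta (- fps_X)) ^ 4 + 16 * fps_X * (psi oo fps_X\<^sup>2) ^ 4) oo fps_X ^ 4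
       = (theta (- fps_X) oo fps_X ^ 4) ^ 4 + 16 * fps_X ^ 4 * (psi oo fps_X ^ 8) ^ 4"
      by (simp add: fps_compose_add_distrib fps_compose_mult_distrib flip: fps_compose_power)
    also have "\<dots> = theta_even ^ 4"
      unfolding jacobi_compose by (simp add: theta_odd_def power_mult_distrib)
    finally show ?thesis by (simp add: theta_even_def fps_compose_power)
  qed
  then have "(theta (- fps_X)) ^ 4 + 16 * fps_X * (psi oo fps_X\<^sup>2) ^ 4 = (theta fps_X) ^ 4"
    by (rule fps_compose_X_power_inj) simp
  then show ?thesis by (simp add: algebra_simps)
qed

section \<open>Reciprocals, the series w = \<open>hmod\<close> and the ratio y\<close>

definition fps_inv1 :: "int fps \<Rightarrow> int fps" where "fps_inv1 f = fps_right_inverse f 1"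

lemma fps_inv1: "fps_nth f 0 = 1 \<Longrightarrow> f * fps_inv1 f = 1"
  unfolding fps_inv1_def by (rule fps_right_inverse) simp

text \<open>\<open>hmod = \<phi>(q)\<^sup>4/\<phi>(-q)\<^sup>4 - 1\<close>, by \<open>jacobi\<close>.\<close>

definition hmod :: "int fps" where
  "hmod = 16 * fps_X * (psi oo fps_X\<^sup>2) ^ 4 * fps_inv1 (theta (- fps_X)) ^ 4"

text \<open>The series y = 2q\<psi>(q^8)/\<phi>(q^4); its exponents are all 1 modulo 4.\<close>

definition theta_ratio :: "int fps" where "theta_ratio = theta_odd * (fps_inv1 (theta fps_X) oo fps_X ^ 4)"

text \<open>\<open>quartic_inv = 1/(1 - theta_ratio\<^sup>4)\<close>, see \<open>quartic_inv_eq\<close>.\<close>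

definition quartic_inv :: "int fps" where "quartic_inv = (1 + hmod) oo fps_X ^ 4"

lemma theta_even_mult_inv: "theta_even * (fps_inv1 (theta fps_X) oo fps_X ^ 4) = 1"
  unfolding theta_even_def by (subst fps_compose_mult_distrib[symmetric]) (simp_all add: fps_inv1)

lemma theta_even_mult_ratio: "theta_even * theta_ratio = theta_odd"
  using theta_even_mult_inv by (simp add: theta_ratio_def mult.left_commute)

lemma psi_compose_compose: "(psi oo fps_X\<^sup>2) oo fps_X ^ 4 = psi oo (fps_X ^ 8 :: int fps)"
  by (subst fps_compose_assoc[symmetric]) (simp_all add: fps_X_power_compose flip: power_mult)

text \<open>By \<open>jacobi_compose\<close>, \<phi>(-q^4)^4 = \<phi>(q^4)^4 (1 - y^4), whence
  w(q^4) = y^4/(1 - y^4) and 1 + w(q^4) = 1/(1 - y^4).\<close>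

lemma hmod_compose: "hmod oo fps_X ^ 4 = theta_ratio ^ 4 * quartic_inv" and quartic_inv_eq: "quartic_inv = 1 + theta_ratio ^ 4 * quartic_inv"
proof -
  define i where "i = fps_inv1 (theta (- fps_X)) oo fps_X ^ 4"
  define a where "a = fps_inv1 (theta fps_X) oo fps_X ^ 4"
  have Aa: "theta_even ^ 4 * a ^ 4 = 1" unfolding a_def power_mult_distrib[symmetric] theta_even_mult_inv by simp
  have "(theta (- fps_X) oo fps_X ^ 4) * i = 1"
    unfolding i_def by (subst fps_compose_mult_distrib[symmetric]) (simp_all add: fps_inv1)
  then have "(theta (- fps_X) oo fps_X ^ 4) ^ 4 * i ^ 4 = 1" by (simp flip: power_mult_distrib)
  then have 1: "theta_even ^ 4 * i ^ 4 = 1 + theta_odd ^ 4 * i ^ 4" by (simp add: jacobi_compose algebra_simps)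
  have 2: "hmod oo fps_X ^ 4 = theta_odd ^ 4 * i ^ 4"
    by (simp add: hmod_def theta_odd_def i_def fps_compose_mult_distrib psi_compose_compose power_mult_distrib
        flip: fps_compose_power)
  have quartic_inv: "quartic_inv = theta_even ^ 4 * i ^ 4" by (simp add: quartic_inv_def fps_compose_add_distrib 1 2)
  have "theta_ratio ^ 4 * quartic_inv = theta_odd ^ 4 * (theta_even ^ 4 * a ^ 4) * i ^ 4"
    by (simp add: quartic_inv theta_ratio_def a_def[symmetric] power_mult_distrib mult_ac)
  then show "hmod oo fps_X ^ 4 = theta_ratio ^ 4 * quartic_inv" by (simp add: Aa 2)
  then show "quartic_inv = 1 + theta_ratio ^ 4 * quartic_inv" by (simp add: quartic_inv_def fps_compose_add_distrib)
qed

lemma theta_eq_even_mult: "theta fps_X = theta_even * (1 + theta_ratio)"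
  by (simp add: distrib_left theta_even_mult_ratio theta_eq_even_plus_odd)

text \<open>Writing 1/(1 - y) as (1 + y)(1 + y^2)/(1 - y^4) moves the denominator into a series in
  q^4.\<close>

lemma fps_inv1_theta_neg: "fps_inv1 (theta (- fps_X)) = (fps_inv1 (theta fps_X) oo fps_X ^ 4) * (1 + theta_ratio) * (1 + theta_ratio\<^sup>2) * quartic_inv"
proof -
  define a where "a = fps_inv1 (theta fps_X) oo fps_X ^ 4"
  have Aa: "theta_even * a = 1" using theta_even_mult_inv by (simp add: a_def)
  have t: "theta (- fps_X) = theta_even * (1 - theta_ratio)"
    by (simp add: right_diff_distrib theta_even_mult_ratio theta_neg_eq_even_minus_odd)
  have "theta (- fps_X) * (a * (1 + theta_ratio) * (1 + theta_ratio\<^sup>2) * quartic_inv) = (theta_even * a) * ((1 - theta_ratio) * (1 + theta_ratio) * (1 + theta_ratio\<^sup>2) * quartic_inv)"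
    unfolding t by (simp only: mult_ac)
  also have "(1 - theta_ratio) * (1 + theta_ratio) * (1 + theta_ratio\<^sup>2) * quartic_inv = quartic_inv - theta_ratio ^ 4 * quartic_inv"
    by (simp add: algebra_simps power4_eq_xxxx power2_eq_square)
  also have "quartic_inv - theta_ratio ^ 4 * quartic_inv = 1" using quartic_inv_eq by (simp add: algebra_simps)
  finally have "theta (- fps_X) * (a * (1 + theta_ratio) * (1 + theta_ratio\<^sup>2) * quartic_inv) = theta (- fps_X) * fps_inv1 (theta (- fps_X))"
    by (simp add: Aa fps_inv1)
  moreover have "theta (- fps_X) \<noteq> 0" using theta_nth_0[of "- fps_X"] by force
  ultimately show ?thesis by (simp add: a_def)
qed

text \<open>The factor 8 comes from (1 + y)^4 - (1 - y)^4 = 8y(1 + y^2); the denominator (1 - y)^4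
  is rationalised by \<open>fps_inv1_theta_neg\<close>.\<close>

lemma hmod_eq: "hmod = 8 * theta_ratio * (1 + theta_ratio\<^sup>2) ^ 5 * (1 + theta_ratio) ^ 4 * quartic_inv ^ 4"
proof -
  define a where "a = fps_inv1 (theta fps_X) oo fps_X ^ 4"
  have Aa: "theta_even * a = 1" using theta_even_mult_inv by (simp add: a_def)
  have t: "theta (- fps_X) = theta_even * (1 - theta_ratio)"
    by (simp add: right_diff_distrib theta_even_mult_ratio theta_neg_eq_even_minus_odd)
  have "hmod = ((theta fps_X) ^ 4 - (theta (- fps_X)) ^ 4) * fps_inv1 (theta (- fps_X)) ^ 4"
    unfolding jacobi hmod_def ..
  also have "\<dots> = ((theta_even * (1 + theta_ratio)) ^ 4 - (theta_even * (1 - theta_ratio)) ^ 4) * (a * (1 + theta_ratio) * (1 + theta_ratio\<^sup>2) * quartic_inv) ^ 4"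
    unfolding fps_inv1_theta_neg a_def[symmetric] unfolding theta_eq_even_mult t ..
  also have "\<dots> = (theta_even * a) ^ 4 * (((1 + theta_ratio) ^ 4 - (1 - theta_ratio) ^ 4) * ((1 + theta_ratio) * (1 + theta_ratio\<^sup>2) * quartic_inv) ^ 4)"
  proof -
    have "(theta_even * (1 + theta_ratio)) ^ 4 - (theta_even * (1 - theta_ratio)) ^ 4 = theta_even ^ 4 * ((1 + theta_ratio) ^ 4 - (1 - theta_ratio) ^ 4)"
      by (simp only: power_mult_distrib right_diff_distrib[symmetric])
    then show ?thesis by (simp add: power_mult_distrib mult_ac)
  qed
  also have "\<dots> = ((1 + theta_ratio) ^ 4 - (1 - theta_ratio) ^ 4) * ((1 + theta_ratio) * (1 + theta_ratio\<^sup>2) * quartic_inv) ^ 4" by (simp add: Aa)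
  also have "(1 + theta_ratio) ^ 4 - (1 - theta_ratio) ^ 4 = 8 * theta_ratio * (1 + theta_ratio\<^sup>2)"
    by (simp add: algebra_simps power4_eq_xxxx power2_eq_square)
  also have "8 * theta_ratio * (1 + theta_ratio\<^sup>2) * ((1 + theta_ratio) * (1 + theta_ratio\<^sup>2) * quartic_inv) ^ 4 = 8 * theta_ratio * (1 + theta_ratio\<^sup>2) ^ 5 * (1 + theta_ratio) ^ 4 * quartic_inv ^ 4"
    by (simp add: power_mult_distrib mult_ac eval_nat_numeral)
  finally show ?thesis .
qed

section \<open>The ring \<int>[w] and its dissection by powers of y\<close>

inductive_set Zhmod :: "int fps set" where
  one: "1 \<in> Zhmod"
| hmod: "hmod \<in> Zhmod"
| add: "f \<in> Zhmod \<Longrightarrow> g \<in> Zhmod \<Longrightarrow> f + g \<in> Zhmod"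
| mult: "f \<in> Zhmod \<Longrightarrow> g \<in> Zhmod \<Longrightarrow> f * g \<in> Zhmod"
| neg: "f \<in> Zhmod \<Longrightarrow> - f \<in> Zhmod"

lemma Zhmod_zero: "0 \<in> Zhmod"
  using Zhmod.add[OF Zhmod.one Zhmod.neg[OF Zhmod.one]] by simp

lemma Zhmod_of_nat: "of_nat n \<in> Zhmod"
  by (induction n) (auto intro: Zhmod.intros Zhmod_zero)

lemma Zhmod_numeral: "numeral n \<in> Zhmod"
  using Zhmod_of_nat[of "numeral n"] by simp

lemma Zhmod_power: "f \<in> Zhmod \<Longrightarrow> f ^ n \<in> Zhmod"
  by (induction n) (auto intro: Zhmod.intros)

lemmas Zhmod_intros = Zhmod.intros Zhmod_zero Zhmod_numeral Zhmod_power

text \<open>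
  The factor \<open>quartic_inv\<close> on the three nontrivial powers of \<open>theta_ratio\<close> makes these combinations with
  coefficients in \<open>\<int>[hmod]\<close> closed under multiplication: \<open>theta_ratio\<^sup>4\<close> alone is not in
  \<open>\<int>[hmod(q\<^sup>4)]\<close>, but \<open>theta_ratio\<^sup>4 * quartic_inv = hmod(q\<^sup>4)\<close> is.
\<close>

definition quartic_comb :: "int fps \<Rightarrow> int fps \<Rightarrow> int fps \<Rightarrow> int fps \<Rightarrow> int fps" where
  "quartic_comb e0 e1 e2 e3 = (e0 oo fps_X ^ 4) +
     quartic_inv * (theta_ratio * (e1 oo fps_X ^ 4) + theta_ratio\<^sup>2 * (e2 oo fps_X ^ 4) + theta_ratio ^ 3 * (e3 oo fps_X ^ 4))"

text \<open>The powers y^4 to y^6 are reduced by grouping y^4 with one u: for u =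
  \<open>quartic_inv\<close> the product y^4 u is \<open>hmod\<close> at q^4, so all coefficients
  remain series in q^4.\<close>

lemma quartic_comb_ring_identity:
  fixes u y e0 e1 e2 e3 f0 f1 f2 f3 :: "'a::comm_ring_1"
  shows "(e0 + u * (y * e1 + y\<^sup>2 * e2 + y ^ 3 * e3)) * (f0 + u * (y * f1 + y\<^sup>2 * f2 + y ^ 3 * f3)) =
     (e0 * f0 + (y ^ 4 * u) * u * (e1 * f3 + e2 * f2 + e3 * f1)) +
     u * (y * (e0 * f1 + e1 * f0 + (y ^ 4 * u) * (e2 * f3 + e3 * f2)) +
          y\<^sup>2 * (e0 * f2 + e2 * f0 + u * (e1 * f1) + (y ^ 4 * u) * (e3 * f3)) +
          y ^ 3 * (e0 * f3 + e3 * f0 + u * (e1 * f2 + e2 * f1)))"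
  by (simp add: algebra_simps eval_nat_numeral)

lemma quartic_comb_mult:
  "quartic_comb e0 e1 e2 e3 * quartic_comb f0 f1 f2 f3 =
     quartic_comb (e0 * f0 + hmod * (1 + hmod) * (e1 * f3 + e2 * f2 + e3 * f1))
          (e0 * f1 + e1 * f0 + hmod * (e2 * f3 + e3 * f2))
          (e0 * f2 + e2 * f0 + (1 + hmod) * (e1 * f1) + hmod * (e3 * f3))
          (e0 * f3 + e3 * f0 + (1 + hmod) * (e1 * f2 + e2 * f1))"
proof -
  have quartic_inv: "1 + hmod oo fps_X ^ 4 = quartic_inv" by (simp add: quartic_inv_def)
  have X: "fps_nth (fps_X ^ 4 :: int fps) 0 = 0" by simp
  note distrib = fps_compose_mult_distrib[OF X]
  show ?thesis
    unfolding quartic_comb_def quartic_comb_ring_identity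
    by (simp only: fps_compose_add_distrib[of _ "_ * _"] fps_compose_add_distrib[of "_ * _"] distrib
        quartic_inv hmod_compose)
qed

lemma quartic_comb_add: "quartic_comb e0 e1 e2 e3 + quartic_comb f0 f1 f2 f3 = quartic_comb (e0 + f0) (e1 + f1) (e2 + f2) (e3 + f3)"
  by (simp add: quartic_comb_def fps_compose_add_distrib algebra_simps)

lemma quartic_comb_uminus: "- quartic_comb e0 e1 e2 e3 = quartic_comb (- e0) (- e1) (- e2) (- e3)"
  by (simp add: quartic_comb_def fps_compose_uminus algebra_simps)

text \<open>The polynomial in y, of degree 15, is sorted by exponents modulo 4, each y^4 being
  grouped with one u. Every term with exponent divisible by 4 contains y^4 u, which becomes a factor
  \<open>hmod\<close>.\<close>

lemma hmod_ring_identity: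
  fixes u y :: "'a::comm_ring_1"
  shows "8 * y * (1 + y\<^sup>2) ^ 5 * (1 + y) ^ 4 * u ^ 4 =
    8 * ((24 * ((y ^ 4 * u) * u ^ 3) + 80 * ((y ^ 4 * u)\<^sup>2 * u\<^sup>2) + 24 * ((y ^ 4 * u) ^ 3 * u)) +
      u * (y * (u ^ 3 + 41 * ((y ^ 4 * u) * u\<^sup>2) + 75 * ((y ^ 4 * u)\<^sup>2 * u) + 11 * (y ^ 4 * u) ^ 3) +
        y\<^sup>2 * (4 * u ^ 3 + 60 * ((y ^ 4 * u) * u\<^sup>2) + 60 * ((y ^ 4 * u)\<^sup>2 * u) + 4 * (y ^ 4 * u) ^ 3) +
        y ^ 3 * (11 * u ^ 3 + 75 * ((y ^ 4 * u) * u\<^sup>2) + 41 * ((y ^ 4 * u)\<^sup>2 * u) + (y ^ 4 * u) ^ 3)))"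
proof -
  have "(1 + y\<^sup>2) ^ 5 * (1 + y) ^ 4 =
    1 + 4 * y + 11 * y ^ 2 + 24 * y ^ 3 + 41 * y ^ 4 + 60 * y ^ 5 + 75 * y ^ 6 + 80 * y ^ 7 + 75 * y ^ 8 +
    60 * y ^ 9 + 41 * y ^ 10 + 24 * y ^ 11 + 11 * y ^ 12 + 4 * y ^ 13 + y ^ 14"
    by (simp add: algebra_simps eval_nat_numeral)
  then have "8 * y * (1 + y\<^sup>2) ^ 5 * (1 + y) ^ 4 * u ^ 4 = 8 * y * u ^ 4 *
    (1 + 4 * y + 11 * y ^ 2 + 24 * y ^ 3 + 41 * y ^ 4 + 60 * y ^ 5 + 75 * y ^ 6 + 80 * y ^ 7 + 75 * y ^ 8 +
    60 * y ^ 9 + 41 * y ^ 10 + 24 * y ^ 11 + 11 * y ^ 12 + 4 * y ^ 13 + y ^ 14)"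
    by (simp only: mult_ac)
  then show ?thesis by (simp add: algebra_simps eval_nat_numeral)
qed

lemma hmod_eq_quartic_comb:
  "hmod = 8 * quartic_comb (hmod * (24 * (1 + hmod) ^ 3 + 80 * (hmod * (1 + hmod)\<^sup>2) + 24 * (hmod\<^sup>2 * (1 + hmod))))
     ((1 + hmod) ^ 3 + 41 * (hmod * (1 + hmod)\<^sup>2) + 75 * (hmod\<^sup>2 * (1 + hmod)) + 11 * hmod ^ 3)
     (4 * (1 + hmod) ^ 3 + 60 * (hmod * (1 + hmod)\<^sup>2) + 60 * (hmod\<^sup>2 * (1 + hmod)) + 4 * hmod ^ 3)
     (11 * (1 + hmod) ^ 3 + 75 * (hmod * (1 + hmod)\<^sup>2) + 41 * (hmod\<^sup>2 * (1 + hmod)) + hmod ^ 3)"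
proof -
  have X: "fps_nth (fps_X ^ 4 :: int fps) 0 = 0" by simp
  have quartic_inv: "1 + hmod oo fps_X ^ 4 = quartic_inv" by (simp add: quartic_inv_def)
  have e0: "hmod * (24 * (1 + hmod) ^ 3 + 80 * (hmod * (1 + hmod)\<^sup>2) + 24 * (hmod\<^sup>2 * (1 + hmod)))
     = 24 * (hmod * (1 + hmod) ^ 3) + 80 * (hmod\<^sup>2 * (1 + hmod)\<^sup>2) + 24 * (hmod ^ 3 * (1 + hmod))"
    by (simp add: distrib_left power2_eq_square power3_eq_cube mult_ac)
  show ?thesis
    unfolding e0 quartic_comb_def
    by (subst hmod_eq, subst hmod_ring_identity)
      (simp only: fps_compose_add_distrib[of _ "_ * _"] fps_compose_add_distrib[of _ "_ ^ _"]
        fps_compose_mult_distrib[OF X] fps_compose_power[OF X, symmetric] numeral_compose quartic_inv hmod_compose)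
qed

lemma numeral_mult_quartic_comb: "numeral n * quartic_comb e0 e1 e2 e3 = quartic_comb (numeral n * e0) (numeral n * e1) (numeral n * e2) (numeral n * e3)"
  by (simp add: quartic_comb_def fps_compose_mult_distrib algebra_simps)

text \<open>Records the two features that drive the induction: the factor 8, and the factor
  \<open>hmod\<close> in the component of exponents divisible by 4.\<close>

lemma hmod_quartic_comb: "\<exists>e0\<in>Zhmod. \<exists>e1\<in>Zhmod. \<exists>e2\<in>Zhmod. \<exists>e3\<in>Zhmod. hmod = 8 * quartic_comb (hmod * e0) e1 e2 e3"
proof -
  have "24 * (1 + hmod) ^ 3 + 80 * (hmod * (1 + hmod)\<^sup>2) + 24 * (hmod\<^sup>2 * (1 + hmod)) \<in> Zhmod"
    "(1 + hmod) ^ 3 + 41 * (hmod * (1 + hmod)\<^sup>2) + 75 * (hmod\<^sup>2 * (1 + hmod)) + 11 * hmod ^ 3 \<in> Zhmod"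
    "4 * (1 + hmod) ^ 3 + 60 * (hmod * (1 + hmod)\<^sup>2) + 60 * (hmod\<^sup>2 * (1 + hmod)) + 4 * hmod ^ 3 \<in> Zhmod"
    "11 * (1 + hmod) ^ 3 + 75 * (hmod * (1 + hmod)\<^sup>2) + 41 * (hmod\<^sup>2 * (1 + hmod)) + hmod ^ 3 \<in> Zhmod"
    by (intro Zhmod_intros)+
  then show ?thesis using hmod_eq_quartic_comb by blast
qed

lemma Zhmod_quartic_comb:
  assumes "f \<in> Zhmod"
  shows "\<exists>e0\<in>Zhmod. \<exists>e1\<in>Zhmod. \<exists>e2\<in>Zhmod. \<exists>e3\<in>Zhmod. f = quartic_comb e0 e1 e2 e3"
  using assms
proof induction
  case one
  have "1 = quartic_comb 1 0 0 0" by (simp add: quartic_comb_def)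
  then show ?case using Zhmod.one Zhmod_zero by blast
next
  case hmod
  obtain e0 e1 e2 e3 where e: "e0 \<in> Zhmod" "e1 \<in> Zhmod" "e2 \<in> Zhmod" "e3 \<in> Zhmod"
    "hmod = quartic_comb (8 * (hmod * e0)) (8 * e1) (8 * e2) (8 * e3)"
    using hmod_quartic_comb unfolding numeral_mult_quartic_comb by blast
  moreover have "8 * (hmod * e0) \<in> Zhmod" "8 * e1 \<in> Zhmod" "8 * e2 \<in> Zhmod" "8 * e3 \<in> Zhmod"
    by (intro Zhmod_intros e)+
  ultimately show ?case by blast
next
  case (add f g)
  then show ?case using quartic_comb_add Zhmod.add by metis
next
  case (mult f g)
  obtain e0 e1 e2 e3 where e: "e0 \<in> Zhmod" "e1 \<in> Zhmod" "e2 \<in> Zhmod" "e3 \<in> Zhmod" "f = quartic_comb e0 e1 e2 e3"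
    using mult by blast
  obtain f0 f1 f2 f3 where f: "f0 \<in> Zhmod" "f1 \<in> Zhmod" "f2 \<in> Zhmod" "f3 \<in> Zhmod" "g = quartic_comb f0 f1 f2 f3"
    using mult by blast
  have "e0 * f0 + hmod * (1 + hmod) * (e1 * f3 + e2 * f2 + e3 * f1) \<in> Zhmod"
    "e0 * f1 + e1 * f0 + hmod * (e2 * f3 + e3 * f2) \<in> Zhmod"
    "e0 * f2 + e2 * f0 + (1 + hmod) * (e1 * f1) + hmod * (e3 * f3) \<in> Zhmod"
    "e0 * f3 + e3 * f0 + (1 + hmod) * (e1 * f2 + e2 * f1) \<in> Zhmod"
    by (intro Zhmod_intros e(1-4) f(1-4))+
  then show ?case unfolding e(5) f(5) quartic_comb_mult by blast
next
  case (neg f)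
  then show ?case using quartic_comb_uminus Zhmod.neg by metis
qed

text \<open>In \<open>quartic_comb_mult\<close> the extra terms of the first component carry a
  factor \<open>hmod\<close>, so both features of \<open>hmod_quartic_comb\<close> survive
  multiplication by \<int>[w].\<close>

lemma hmod_mult_Zhmod_quartic_comb:
  assumes "f \<in> Zhmod"
  shows "\<exists>e0\<in>Zhmod. \<exists>e1\<in>Zhmod. \<exists>e2\<in>Zhmod. \<exists>e3\<in>Zhmod. hmod * f = 8 * quartic_comb (hmod * e0) e1 e2 e3"
proof -
  obtain f0 f1 f2 f3 where f: "f0 \<in> Zhmod" "f1 \<in> Zhmod" "f2 \<in> Zhmod" "f3 \<in> Zhmod" "f = quartic_comb f0 f1 f2 f3"
    using Zhmod_quartic_comb[OF assms] by blast
  obtain e0 e1 e2 e3 where e: "e0 \<in> Zhmod" "e1 \<in> Zhmod" "e2 \<in> Zhmod" "e3 \<in> Zhmod"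
    "hmod = 8 * quartic_comb (hmod * e0) e1 e2 e3"
    using hmod_quartic_comb by blast
  have "hmod * f = 8 * (quartic_comb (hmod * e0) e1 e2 e3 * quartic_comb f0 f1 f2 f3)"
    unfolding f(5) by (subst e(5)) (rule mult.assoc)
  also have "\<dots> = 8 * quartic_comb (hmod * (e0 * f0 + (1 + hmod) * (e1 * f3 + e2 * f2 + e3 * f1)))
     (hmod * e0 * f1 + e1 * f0 + hmod * (e2 * f3 + e3 * f2))
     (hmod * e0 * f2 + e2 * f0 + (1 + hmod) * (e1 * f1) + hmod * (e3 * f3))
     (hmod * e0 * f3 + e3 * f0 + (1 + hmod) * (e1 * f2 + e2 * f1))"
    unfolding quartic_comb_mult by (simp only: distrib_left[of hmod "_ * _"] mult.assoc)
  finally have eq: "hmod * f = \<dots>" .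
  have "e0 * f0 + (1 + hmod) * (e1 * f3 + e2 * f2 + e3 * f1) \<in> Zhmod"
    "hmod * e0 * f1 + e1 * f0 + hmod * (e2 * f3 + e3 * f2) \<in> Zhmod"
    "hmod * e0 * f2 + e2 * f0 + (1 + hmod) * (e1 * f1) + hmod * (e3 * f3) \<in> Zhmod"
    "hmod * e0 * f3 + e3 * f0 + (1 + hmod) * (e1 * f2 + e2 * f1) \<in> Zhmod"
    by (intro Zhmod_intros e(1-4) f(1-4))+
  then show ?thesis using eq by blast
qed

section \<open>Coefficients at exponents 0 and 1 modulo 4\<close>

definition psi2 :: "int fps" where "psi2 = psi oo fps_X\<^sup>2"

lemma dissection4_nth:
  fixes f :: "int fps"
  assumes "f = (p0 oo fps_X ^ 4) + fps_X * (p1 oo fps_X ^ 4) + fps_X\<^sup>2 * (p2 oo fps_X ^ 4) +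
    fps_X ^ 3 * (p3 oo fps_X ^ 4)"
  shows "fps_nth f (4 * n) = fps_nth p0 n" "fps_nth f (4 * n + 1) = fps_nth p1 n"
proof -
  have *: "\<not> 4 dvd (4 * n - 1 :: nat) \<or> n = 0" "\<not> 4 dvd (4 * n - 2 :: nat) \<or> n = 0"
    "\<not> 4 dvd (4 * n - 3 :: nat) \<or> n = 0" "\<not> 4 dvd (4 * n + 1 - 2 :: nat) \<or> n = 0"
    "\<not> 4 dvd (4 * n + 1 - 3 :: nat) \<or> n = 0" "\<not> 4 dvd (4 * n + 1 :: nat)" by presburger+
  show "fps_nth f (4 * n) = fps_nth p0 n" "fps_nth f (4 * n + 1) = fps_nth p1 n"
    unfolding assms using * by (auto simp: fps_nth_compose_X_power fps_X_power_mult_nth)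
qed

text \<open>For j \<le> 3 the product \<phi>(q^4) y^j is q^j times a series in q^4, and for j = 1 it
  is 2q\<psi>(q^8). Only the residues 0 and 1 are made explicit.\<close>

lemma dissection4:
  "\<exists>p2 p3. theta_even * ((e0 oo fps_X ^ 4) + theta_ratio * (e1 oo fps_X ^ 4) + theta_ratio\<^sup>2 * (e2 oo fps_X ^ 4) + theta_ratio ^ 3 * (e3 oo fps_X ^ 4))
    = ((theta fps_X * e0) oo fps_X ^ 4) + fps_X * ((2 * psi2 * e1) oo fps_X ^ 4) +
      fps_X\<^sup>2 * (p2 oo fps_X ^ 4) + fps_X ^ 3 * (p3 oo fps_X ^ 4)"
proof -
  define s where "s = 2 * psi2"
  define a where "a = fps_inv1 (theta fps_X)"
  have theta_odd: "theta_odd = fps_X * (s oo fps_X ^ 4)"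
    by (simp add: theta_odd_def s_def psi2_def fps_compose_mult_distrib psi_compose_compose)
  have theta_ratio: "theta_ratio = theta_odd * (a oo fps_X ^ 4)" by (simp add: theta_ratio_def a_def)
  have Ay: "theta_even * theta_ratio = theta_odd" by (rule theta_even_mult_ratio)
  then have Ay2: "theta_even * theta_ratio\<^sup>2 = theta_odd * theta_odd * (a oo fps_X ^ 4)" and Ay3: "theta_even * theta_ratio ^ 3 = theta_odd * theta_odd * theta_odd * (a oo fps_X ^ 4)\<^sup>2"
    by (simp_all add: power2_eq_square power3_eq_cube theta_ratio mult_ac)
      (metis Ay mult.assoc mult.commute theta_ratio)+
  have "theta_even * ((e0 oo fps_X ^ 4) + theta_ratio * (e1 oo fps_X ^ 4) + theta_ratio\<^sup>2 * (e2 oo fps_X ^ 4) + theta_ratio ^ 3 * (e3 oo fps_X ^ 4))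
     = theta_even * (e0 oo fps_X ^ 4) + (theta_even * theta_ratio) * (e1 oo fps_X ^ 4) + (theta_even * theta_ratio\<^sup>2) * (e2 oo fps_X ^ 4) +
       (theta_even * theta_ratio ^ 3) * (e3 oo fps_X ^ 4)"
    by (simp only: distrib_left mult.assoc)
  also have "\<dots> = ((theta fps_X * e0) oo fps_X ^ 4) + fps_X * ((s * e1) oo fps_X ^ 4) +
      fps_X\<^sup>2 * ((s * s * a * e2) oo fps_X ^ 4) + fps_X ^ 3 * ((s * s * s * a\<^sup>2 * e3) oo fps_X ^ 4)"
    unfolding Ay Ay2 Ay3 unfolding theta_odd theta_even_def
    by (simp add: fps_compose_mult_distrib power2_eq_square power3_eq_cube mult_ac)
  finally show ?thesis unfolding s_def by (intro exI)
qed

lemma theta_even_mult_nth: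
  "fps_nth (theta_even * ((e0 oo fps_X ^ 4) + theta_ratio * (e1 oo fps_X ^ 4) + theta_ratio\<^sup>2 * (e2 oo fps_X ^ 4) + theta_ratio ^ 3 * (e3 oo fps_X ^ 4))) (4 * n)
    = fps_nth (theta fps_X * e0) n"
  "fps_nth (theta_even * ((e0 oo fps_X ^ 4) + theta_ratio * (e1 oo fps_X ^ 4) + theta_ratio\<^sup>2 * (e2 oo fps_X ^ 4) + theta_ratio ^ 3 * (e3 oo fps_X ^ 4))) (4 * n + 1)
    = fps_nth (2 * psi2 * e1) n"
proof -
  obtain p2 p3 where "theta_even * ((e0 oo fps_X ^ 4) + theta_ratio * (e1 oo fps_X ^ 4) + theta_ratio\<^sup>2 * (e2 oo fps_X ^ 4) + theta_ratio ^ 3 * (e3 oo fps_X ^ 4))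
    = ((theta fps_X * e0) oo fps_X ^ 4) + fps_X * ((2 * psi2 * e1) oo fps_X ^ 4) +
      fps_X\<^sup>2 * (p2 oo fps_X ^ 4) + fps_X ^ 3 * (p3 oo fps_X ^ 4)"
    using dissection4[of e0 e1 e2 e3] by (elim exE)
  from dissection4_nth[OF this] show
    "fps_nth (theta_even * ((e0 oo fps_X ^ 4) + theta_ratio * (e1 oo fps_X ^ 4) + theta_ratio\<^sup>2 * (e2 oo fps_X ^ 4) + theta_ratio ^ 3 * (e3 oo fps_X ^ 4))) (4 * n)
      = fps_nth (theta fps_X * e0) n"
    "fps_nth (theta_even * ((e0 oo fps_X ^ 4) + theta_ratio * (e1 oo fps_X ^ 4) + theta_ratio\<^sup>2 * (e2 oo fps_X ^ 4) + theta_ratio ^ 3 * (e3 oo fps_X ^ 4))) (4 * n + 1)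
      = fps_nth (2 * psi2 * e1) n" .
qed

text \<open>Here \<phi>(q) = \<phi>(q^4)(1 + y). In (1 + y) times a quartic combination, residue 0
  collects the first component and y times the y^3 term; both are multiples of \<open>hmod\<close>.
  Residue 1 gains the factor 2 of \<open>theta_odd\<close>, which turns 8 into 16.\<close>

lemma theta_hmod_nth:
  assumes "f \<in> Zhmod"
  shows "\<exists>g\<in>Zhmod. \<exists>h\<in>Zhmod. \<forall>n. fps_nth (theta fps_X * hmod * f) (4 * n) = 8 * fps_nth (theta fps_X * hmod * g) n \<and>
     fps_nth (theta fps_X * hmod * f) (4 * n + 1) = 16 * fps_nth (psi2 * h) n"
proof -
  obtain e0 e1 e2 e3 where e: "hmod * f = 8 * quartic_comb (hmod * e0) e1 e2 e3" "e0 \<in> Zhmod" "e1 \<in> Zhmod" "e2 \<in> Zhmod" "e3 \<in> Zhmod"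
    using hmod_mult_Zhmod_quartic_comb[OF assms] by blast
  define c where "c e = e oo (fps_X ^ 4 :: int fps)" for e :: "int fps"
  have cm: "c (a * b) = c a * c b" and ca: "c (a + b) = c a + c b" for a b
    by (simp_all add: c_def fps_compose_mult_distrib fps_compose_add_distrib)
  have cw: "c hmod = theta_ratio ^ 4 * quartic_inv" and cu: "c (1 + hmod) = quartic_inv"
    by (simp_all only: c_def hmod_compose quartic_inv_def)
  have "theta fps_X * hmod * f = theta_even * ((1 + theta_ratio) * (8 * quartic_comb (hmod * e0) e1 e2 e3))"
    unfolding e(1)[symmetric] theta_eq_even_mult by (simp only: mult.assoc)
  also have "(1 + theta_ratio) * (8 * quartic_comb (hmod * e0) e1 e2 e3) = c (8 * (hmod * (e0 + e3))) +
      theta_ratio * c (8 * (hmod * e0 + (1 + hmod) * e1)) + theta_ratio\<^sup>2 * c (8 * ((1 + hmod) * (e1 + e2))) +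
      theta_ratio ^ 3 * c (8 * ((1 + hmod) * (e2 + e3)))"
  proof -
    have 8: "c 8 = 8" by (simp add: c_def)
    show ?thesis
      unfolding quartic_comb_def c_def[symmetric] cm ca[of _ "_ * _"] ca[of e0] ca[of e1] ca[of e2] cw cu 8
      by (simp add: algebra_simps eval_nat_numeral)
  qed
  finally have eq: "theta fps_X * hmod * f = theta_even * (c (8 * (hmod * (e0 + e3))) +
      theta_ratio * c (8 * (hmod * e0 + (1 + hmod) * e1)) + theta_ratio\<^sup>2 * c (8 * ((1 + hmod) * (e1 + e2))) +
      theta_ratio ^ 3 * c (8 * ((1 + hmod) * (e2 + e3))))" .
  have "fps_nth (theta fps_X * hmod * f) (4 * n) = 8 * fps_nth (theta fps_X * hmod * (e0 + e3)) n \<and>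
     fps_nth (theta fps_X * hmod * f) (4 * n + 1) = 16 * fps_nth (psi2 * (hmod * e0 + (1 + hmod) * e1)) n" for n
  proof -
    have 1: "theta fps_X * (8 * (hmod * (e0 + e3))) = fps_const 8 * (theta fps_X * hmod * (e0 + e3))"
      by (simp add: numeral_fps_const mult_ac)
    have 2: "2 * psi2 * (8 * (hmod * e0 + (1 + hmod) * e1)) = fps_const 16 * (psi2 * (hmod * e0 + (1 + hmod) * e1))"
    proof -
      have "2 * psi2 * (8 * h) = 16 * (psi2 * h)" for h by (simp add: mult_ac)
      then show ?thesis by (simp only: numeral_fps_const)
    qed
    show ?thesis
      unfolding eq c_def theta_even_mult_nth 1 2 by simp
  qed
  moreover have "e0 + e3 \<in> Zhmod" "hmod * e0 + (1 + hmod) * e1 \<in> Zhmod" by (intro Zhmod_intros e)+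
  ultimately show ?thesis by (intro bexI allI)
qed

text \<open>By \<open>theta_neg_mult_v0_quarter\<close> the series is \<phi>(q^4)(1 + y)^2/(1 - y),
  that is \<phi>(q^4)/(1 - y^4) times (1 + y)^3 (1 + y^2) = 1 + 3y + 4y^2 + 4y^3 + 3y^4 +
  y^5.\<close>

lemma v0_quarter_eq: "v0_quarter = theta_even * ((1 + 4 * hmod oo fps_X ^ 4) + theta_ratio * (3 + 4 * hmod oo fps_X ^ 4) +
   theta_ratio\<^sup>2 * (4 * (1 + hmod) oo fps_X ^ 4) + theta_ratio ^ 3 * (4 * (1 + hmod) oo fps_X ^ 4))"
proof -
  define a where "a = fps_inv1 (theta fps_X) oo fps_X ^ 4"
  have Aa: "theta_even * a = 1" using theta_even_mult_inv by (simp add: a_def)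
  have "v0_quarter = v0_quarter * (theta (- fps_X) * fps_inv1 (theta (- fps_X)))" by (simp add: fps_inv1)
  also have "\<dots> = (theta (- fps_X) * v0_quarter) * fps_inv1 (theta (- fps_X))" by (simp only: mult_ac)
  also have "\<dots> = (theta_even * (1 + theta_ratio))\<^sup>2 * (a * (1 + theta_ratio) * (1 + theta_ratio\<^sup>2) * quartic_inv)"
    unfolding theta_neg_mult_v0_quarter fps_inv1_theta_neg a_def[symmetric] unfolding theta_eq_even_mult ..
  also have "\<dots> = (theta_even * a) * (theta_even * ((1 + theta_ratio) ^ 3 * (1 + theta_ratio\<^sup>2) * quartic_inv))"
    by (simp add: power_mult_distrib power2_eq_square power3_eq_cube mult_ac)
  also have "\<dots> = theta_even * ((quartic_inv + 3 * (theta_ratio ^ 4 * quartic_inv)) + theta_ratio * (3 * quartic_inv + theta_ratio ^ 4 * quartic_inv) + theta_ratio\<^sup>2 * (4 * quartic_inv) + theta_ratio ^ 3 * (4 * quartic_inv))"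
    unfolding Aa by (simp add: algebra_simps eval_nat_numeral)
  also have "\<dots> = theta_even * ((1 + 4 * hmod oo fps_X ^ 4) + theta_ratio * (3 + 4 * hmod oo fps_X ^ 4) +
     theta_ratio\<^sup>2 * (4 * (1 + hmod) oo fps_X ^ 4) + theta_ratio ^ 3 * (4 * (1 + hmod) oo fps_X ^ 4))"
  proof -
    define c where "c = theta_ratio ^ 4 * quartic_inv"
    have quartic_inv: "quartic_inv = 1 + c" and hmod: "hmod oo fps_X ^ 4 = c" unfolding c_def by (rule quartic_inv_eq, rule hmod_compose)
    show ?thesis
      unfolding c_def[symmetric] unfolding quartic_inv by (simp add: algebra_simps hmod fps_compose_add_distrib fps_compose_mult_distrib)
  qed
  finally show ?thesis .
qed

section \<open>Divisibility by powers of 2\<close>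

text \<open>The first extraction gives \<phi>(1 + 4w), hence the factor 2^2. Each further one fixes
  \<phi> and contributes a factor 8 by \<open>theta_hmod_nth\<close>.\<close>

lemma v0_quarter_nth_4_power:
  "\<exists>f\<in>Zhmod. \<forall>n. fps_nth v0_quarter (4 ^ Suc a * n) =
     fps_nth (theta fps_X) n + 2 ^ (3 * a + 2) * fps_nth (theta fps_X * hmod * f) n"
proof (induction a)
  case 0
  have "fps_nth v0_quarter (4 * n) = fps_nth (theta fps_X) n + 4 * fps_nth (theta fps_X * hmod * 1) n" for n
  proof -
    have "fps_nth v0_quarter (4 * n) = fps_nth (theta fps_X * (1 + 4 * hmod)) n" unfolding v0_quarter_eq by (rule theta_even_mult_nth(1))
    also have "theta fps_X * (1 + 4 * hmod) = theta fps_X + fps_const 4 * (theta fps_X * hmod * 1)"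
      by (simp add: numeral_fps_const algebra_simps)
    finally show ?thesis by simp
  qed
  then show ?case using Zhmod.one by (intro bexI[of _ 1]) (simp_all add: mult.assoc)
next
  case (Suc a)
  then obtain f where f: "f \<in> Zhmod" "\<And>n. fps_nth v0_quarter (4 ^ Suc a * n) =
     fps_nth (theta fps_X) n + 2 ^ (3 * a + 2) * fps_nth (theta fps_X * hmod * f) n" by blast
  obtain g where g: "g \<in> Zhmod" "\<And>n. fps_nth (theta fps_X * hmod * f) (4 * n) = 8 * fps_nth (theta fps_X * hmod * g) n"
    using theta_hmod_nth[OF f(1)] by blast
  \<comment> \<open>By \<open>theta_dissection\<close> the terms of \<phi>(q) with exponents
    divisible by 4 form \<phi>(q^4), so \<phi> reproduces itself.\<close>
  have th: "fps_nth (theta fps_X) (4 * n) = fps_nth (theta fps_X) n" for n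
  proof -
    have "theta fps_X = (theta fps_X oo fps_X ^ 4) + fps_X * ((2 * psi2) oo fps_X ^ 4) +
        fps_X\<^sup>2 * (0 oo fps_X ^ 4) + fps_X ^ 3 * (0 oo fps_X ^ 4)"
      by (subst theta_dissection)
        (simp add: psi2_def fps_compose_mult_distrib psi_compose_compose mult_ac)
    then show ?thesis by (rule dissection4_nth(1))
  qed
  have "fps_nth v0_quarter (4 ^ Suc (Suc a) * n) =
     fps_nth (theta fps_X) n + 2 ^ (3 * Suc a + 2) * fps_nth (theta fps_X * hmod * g) n" for n
  proof -
    have "4 ^ Suc (Suc a) * n = 4 ^ Suc a * (4 * n)" by simp
    then show ?thesis by (simp only: f(2) th g(2)) (simp add: power_add)
  qed
  then show ?case using g(1) by blast
qed

section \<open>Powers of 2 in the even part of w\<close>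

text \<open>The difference 1/\<phi>(-q)^4 - 1/\<phi>(q)^4 has numerator \<phi>(q)^4 - \<phi>(-q)^4
  over the common denominator, so \<open>jacobi\<close> supplies a second factor 16.\<close>

lemma hmod_add_hmod_minus: "\<exists>r. hmod + (hmod oo - fps_X) = fps_const 256 * r"
proof -
  define i j where "i = fps_inv1 (theta (- fps_X))" and "j = i oo - fps_X"
  have i: "theta (- fps_X) * i = 1" by (simp add: i_def fps_inv1)
  have "(theta (- fps_X) * i) oo - fps_X = 1" by (simp add: i)
  then have j: "theta fps_X * j = 1"
    by (simp add: fps_compose_mult_distrib theta_compose fps_compose_uminus j_def)
  define p where "p = psi2 ^ 4"
  have p: "p oo - fps_X = p"
    by (simp add: p_def psi2_def compose_X_power_even_minus flip: fps_compose_power)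
  have hmod: "hmod = 16 * fps_X * p * i ^ 4" by (simp add: hmod_def psi2_def p_def i_def)
  have "hmod oo - fps_X = - (16 * fps_X * p * j ^ 4)"
    unfolding hmod by (simp add: fps_compose_mult_distrib p j_def flip: fps_compose_power)
  then have "hmod + (hmod oo - fps_X) = 16 * fps_X * p * (i ^ 4 - j ^ 4)"
    by (simp add: hmod right_diff_distrib)
  also have "i ^ 4 - j ^ 4 = (theta fps_X * j) ^ 4 * i ^ 4 - (theta (- fps_X) * i) ^ 4 * j ^ 4"
    by (simp add: i j)
  also have "\<dots> = ((theta fps_X) ^ 4 - (theta (- fps_X)) ^ 4) * (i * j) ^ 4"
    by (simp add: power_mult_distrib left_diff_distrib right_diff_distrib mult_ac)
  also have "\<dots> = 16 * fps_X * p * (i * j) ^ 4" unfolding jacobi p_def psi2_def ..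
  also have "16 * fps_X * p * (16 * fps_X * p * (i * j) ^ 4) = fps_const 256 * (fps_X * p * (fps_X * p) * (i * j) ^ 4)"
    by (simp add: mult_ac flip: numeral_fps_const)
  finally show ?thesis by blast
qed

text \<open>As \<psi>(q^2) is even, twice this coefficient is a coefficient of \<psi>(q^2)(w(q) +
  w(-q)); halving 256 leaves 2^7.\<close>

lemma psi2_hmod_nth_even: "2 ^ 7 dvd fps_nth (psi2 * hmod) (2 * n)"
proof -
  obtain r where r: "hmod + (hmod oo - fps_X) = fps_const 256 * r" using hmod_add_hmod_minus by blast
  have "(psi2 * hmod) + ((psi2 * hmod) oo - fps_X) = fps_const 256 * (psi2 * r)"
    using r by (simp add: fps_compose_mult_distrib psi2_def compose_X_power_even_minus
        distrib_left[symmetric] mult.left_commute)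
  then have "fps_nth (psi2 * hmod) (2 * n) + fps_nth ((psi2 * hmod) oo - fps_X) (2 * n) = 256 * fps_nth (psi2 * r) (2 * n)"
    by (metis fps_add_nth fps_mult_left_const_nth)
  then have "2 * fps_nth (psi2 * hmod) (2 * n) = 256 * fps_nth (psi2 * r) (2 * n)"
    by (simp add: fps_compose_uminus')
  then have "fps_nth (psi2 * hmod) (2 * n) = 2 ^ 7 * fps_nth (psi2 * r) (2 * n)" by simp
  then show ?thesis by simp
qed

text \<open>Since w^2 is divisible by 256, only the constant and the linear coefficient have to be
  tracked, and \<open>h\<close> may be an arbitrary series.\<close>

lemma Zhmod_linear_part:
  assumes "f \<in> Zhmod"
  shows "\<exists>c d h. f = fps_const c + fps_const d * hmod + hmod * hmod * h"
  using assms
proof induction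
  case one
  show ?case by (rule exI[of _ 1], rule exI[of _ 0], rule exI[of _ 0]) simp
next
  case hmod
  show ?case by (rule exI[of _ 0], rule exI[of _ 1], rule exI[of _ 0]) simp
next
  case (add f g)
  then obtain c d h c' d' h' where "f = fps_const c + fps_const d * hmod + hmod * hmod * h"
    "g = fps_const c' + fps_const d' * hmod + hmod * hmod * h'" by blast
  then have "f + g = fps_const (c + c') + fps_const (d + d') * hmod + hmod * hmod * (h + h')"
    by (simp add: algebra_simps flip: fps_const_add)
  then show ?case by blast
next
  case (mult f g)
  then obtain c d h c' d' h' where "f = fps_const c + fps_const d * hmod + hmod * hmod * h"
    "g = fps_const c' + fps_const d' * hmod + hmod * hmod * h'" by blast
  then have "f * g = fps_const (c * c') + fps_const (c * d' + d * c') * hmod + hmod * hmod *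
      (fps_const c * h' + fps_const c' * h + fps_const d * fps_const d' +
       hmod * (fps_const d * h' + fps_const d' * h) + hmod * hmod * h * h')"
    by (simp add: algebra_simps flip: fps_const_add fps_const_mult)
  then show ?case by blast
next
  case (neg f)
  then obtain c d h where "f = fps_const c + fps_const d * hmod + hmod * hmod * h" by blast
  then have "- f = fps_const (- c) + fps_const (- d) * hmod + hmod * hmod * (- h)"
    by (simp add: algebra_simps flip: fps_const_neg)
  then show ?case by blast
qed

lemma psi2_nth_nontriangular:
  assumes "\<nexists>k. n = k * (k + 1) div 2"
  shows "fps_nth psi2 (2 * n) = 0"
  using psi_nth_nontriangular[OF assms] by (simp add: psi2_def fps_nth_compose_X_power)

text \<open>The constant part of f vanishes at 2n because n is not triangular, the linear part is
  \<open>psi2_hmod_nth_even\<close>, and the rest is divisible by 2^8.\<close>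

lemma psi2_Zhmod_nth:
  assumes "\<nexists>k. n = k * (k + 1) div 2" "f \<in> Zhmod"
  shows "2 ^ 7 dvd fps_nth (psi2 * f) (2 * n)"
proof -
  obtain c d h where f: "f = fps_const c + fps_const d * hmod + hmod * hmod * h"
    using Zhmod_linear_part[OF assms(2)] by blast
  define t where "t = fps_X * (psi oo fps_X\<^sup>2) ^ 4 * fps_inv1 (theta (- fps_X)) ^ 4"
  have hmod: "hmod = fps_const 16 * t" by (simp add: hmod_def t_def mult.assoc numeral_fps_const)
  have "hmod * hmod * h = fps_const 256 * (t * t * h)"
    unfolding hmod by (simp add: mult_ac flip: numeral_fps_const)
  then have "psi2 * f = fps_const c * psi2 + fps_const d * (psi2 * hmod) + fps_const 256 * (psi2 * (t * t * h))"
    unfolding f by (simp only: distrib_left mult_ac)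
  then have "fps_nth (psi2 * f) (2 * n) = d * fps_nth (psi2 * hmod) (2 * n) +
      2 ^ 7 * (2 * fps_nth (psi2 * (t * t * h)) (2 * n))"
    by (simp add: psi2_nth_nontriangular[OF assms(1)])
  then show ?thesis using psi2_hmod_nth_even by simp
qed

text \<open>One more factor 2 is proved for \<open>v0_quarter\<close>, whose coefficient at 4^a (8n
  + 1) is twice the value in question.\<close>

lemma v0_divisible:
  assumes "\<nexists>k. n = k * (k + 1) div 2"
  shows "2 ^ (3 * a + 9) dvd v0 (2 ^ (2 * a + 2) * (8 * n + 1))"
proof -
  have "2 ^ (3 * a + 10) dvd fps_nth v0_quarter (4 ^ a * (8 * n + 1))"
  proof (cases a)
    case 0
    \<comment> \<open>Here 8n + 1 = 4(2n) + 1 has residue 1, and the part 6\<psi>(q^2) vanishes at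
      2n. The rest gives 8 * 2^7 = 2^10.\<close>
    have "fps_nth v0_quarter (4 * (2 * n) + 1) = fps_nth (2 * psi2 * (3 + 4 * hmod)) (2 * n)"
      unfolding v0_quarter_eq by (rule theta_even_mult_nth(2))
    also have "2 * psi2 * (3 + 4 * hmod) = fps_const 6 * psi2 + fps_const 8 * (psi2 * hmod)"
      by (simp add: algebra_simps flip: numeral_fps_const)
    also have "fps_nth \<dots> (2 * n) = 8 * fps_nth (psi2 * hmod) (2 * n)"
      by (simp add: psi2_nth_nontriangular[OF assms])
    finally have "fps_nth v0_quarter (8 * n + 1) = 8 * fps_nth (psi2 * hmod) (2 * n)" by simp
    moreover have "8 * 2 ^ 7 dvd 8 * fps_nth (psi2 * hmod) (2 * n)"
      by (rule mult_dvd_mono[OF dvd_refl psi2_hmod_nth_even])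
    ultimately show ?thesis by (simp add: 0)
  next
    case (Suc b)
    obtain f where f: "f \<in> Zhmod" "\<And>n. fps_nth v0_quarter (4 ^ Suc b * n) =
       fps_nth (theta fps_X) n + 2 ^ (3 * b + 2) * fps_nth (theta fps_X * hmod * f) n"
      using v0_quarter_nth_4_power by blast
    obtain h where h: "h \<in> Zhmod" "\<And>n. fps_nth (theta fps_X * hmod * f) (4 * n + 1) = 16 * fps_nth (psi2 * h) n"
      using theta_hmod_nth[OF f(1)] by blast
    \<comment> \<open>The \<phi> term vanishes because 8n + 1 is not a square. The exponents of 2
      add up to (3b + 2) + 4 + 7 = 3a + 10, as a = b + 1.\<close>
    have "fps_nth v0_quarter (4 ^ a * (8 * n + 1)) = 2 ^ (3 * b + 2) * (16 * fps_nth (psi2 * h) (2 * n))"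
      using f(2)[of "8 * n + 1"] h(2)[of "2 * n"] theta_X_nth_nontriangular[OF assms] by (simp add: Suc)
    moreover have "2 ^ (3 * b + 2) * (16 * 2 ^ 7) dvd 2 ^ (3 * b + 2) * (16 * fps_nth (psi2 * h) (2 * n))"
      by (intro mult_dvd_mono dvd_refl psi2_Zhmod_nth assms h(1))
    moreover have "2 ^ (3 * b + 2) * (16 * 2 ^ 7) = (2 ^ (3 * a + 10) :: int)"
      by (simp add: Suc power_add)
    ultimately show ?thesis by (simp only:)
  qed
  also have "fps_nth v0_quarter (4 ^ a * (8 * n + 1)) = 2 * v0 (2 ^ (2 * a + 2) * (8 * n + 1))"
  proof -
    have "4 * (4 ^ a * (8 * n + 1)) = 2 ^ (2 * a + 2) * (8 * n + 1)"
      by (simp add: power_add power_mult)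
    moreover have "fps_nth v0_quarter (4 ^ a * (8 * n + 1)) = 2 * v0 (4 * (4 ^ a * (8 * n + 1)))"
      by (simp add: v0_quarter_def)
    ultimately show ?thesis by (simp only:)
  qed
  finally have "2 * 2 ^ (3 * a + 9) dvd 2 * v0 (2 ^ (2 * a + 2) * (8 * n + 1))"
    by (simp only: power_Suc[symmetric] add_Suc_right[symmetric]) (simp add: eval_nat_numeral)
  then show ?thesis by (simp only: dvd_mult_cancel_left) simp
qed

lemma triangular_if_odd_square:
  assumes "(8 * n + 1) = (m::nat)\<^sup>2"
  shows "\<exists>k. n = k * (k + 1) div 2"
proof -
  have "odd (8 * n + 1)" by simp
  then have "odd m" unfolding assms by simp
  then obtain k where "m = 2 * k + 1" by (rule oddE)
  then have "n = k * (k + 1) div 2" using assms odd_square_eq[of k] by simp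
  then show ?thesis ..
qed

theorem theorem1p3:
  fixes n \<alpha> \<beta> p :: nat
  assumes "\<not> (\<exists>k::nat. n = k * (k + 1) div 2)"
    and "prime p" and "p \<ge> 3"
  shows "[v0 (2 ^ (2 * \<alpha> + 2) * p ^ (2 * \<beta>) * (8 * n + 1)) = 0] (mod 2 ^ (3 * \<alpha> + 9))"
proof -
  define q where "q = p ^ \<beta>"
  have "odd p" using assms(2,3) prime_odd_nat[of p] by simp
  then have "odd q" by (simp add: q_def)
  then obtain j where j: "q = 2 * j + 1" by (rule oddE)
  \<comment> \<open>The square of the odd number \<open>q\<close> is 8T + 1 with T = j(j+1)/2, so
    \<open>q^2 * (8n + 1)\<close> is again of the form 8N + 1; this reduces the claim to the case
    without p.\<close>
  define N where "N = (j * (j + 1) div 2) * (8 * n + 1) + n"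
  have N: "q\<^sup>2 * (8 * n + 1) = 8 * N + 1"
    unfolding j odd_square_eq N_def by (simp add: algebra_simps)
  \<comment> \<open>For triangular N the number 8N + 1 would be a square divisible by
    \<open>q^2\<close>, so 8n + 1 would be a square and n triangular.\<close>
  have "\<nexists>k. N = k * (k + 1) div 2"
  proof
    assume "\<exists>k. N = k * (k + 1) div 2"
    then obtain k where "q\<^sup>2 * (8 * n + 1) = (2 * k + 1)\<^sup>2" unfolding N odd_square_eq by blast
    moreover from this have "q\<^sup>2 dvd (2 * k + 1)\<^sup>2" by (metis dvd_triv_left)
    then have "q dvd 2 * k + 1" by simp
    then obtain m where "2 * k + 1 = q * m" ..
    ultimately have "q\<^sup>2 * (8 * n + 1) = q\<^sup>2 * m\<^sup>2" by (simp add: power_mult_distrib)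
    moreover have "q\<^sup>2 \<noteq> 0" using j by simp
    ultimately have "8 * n + 1 = m\<^sup>2" by (metis mult_left_cancel)
    then show False using triangular_if_odd_square assms(1) by blast
  qed
  then have "2 ^ (3 * \<alpha> + 9) dvd v0 (2 ^ (2 * \<alpha> + 2) * (8 * N + 1))" by (rule v0_divisible)
  also have "2 ^ (2 * \<alpha> + 2) * (8 * N + 1) = 2 ^ (2 * \<alpha> + 2) * p ^ (2 * \<beta>) * (8 * n + 1)"
    unfolding N[symmetric] q_def power_mult[symmetric] by (simp only: mult.commute[of \<beta> 2] mult.assoc)
  finally show ?thesis by (simp only: cong_0_iff)
qed

end
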